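(* Let $(\mathcal A,\mathcal A')$ be a counterexample (in the sense defined in the context) with $d$ lines, put $r=r(\mathcal A)$ and $m=m(\mathcal A)$, let $L\in\mathcal A$, $\mathcal B=\mathcal A\setminus\{L\}$, and $\mathcal B'=\mathcal A'\setminus\{L'\}$. Then $r(\mathcal B)\in\{r-1,r\}$ and $r(\mathcal B')\ge r$. Moreover: (i) if $r(\mathcal B)=r$, then $r_L\le r+1$; (ii) if $r(\mathcal B)=r-1$, then $(\mathcal B,\mathcal B')$ is a counterexample with $d-1$ lines, with $r(\mathcal B)=r-1$ and $m(\mathcal B)\le m$. In particular, if there is no counterexample $(\mathcal C,\mathcal C')$ with $d-1$ lines, $r(\mathcal C)=r-1$ and $m(\mathcal C)\le m$, then every line of $\mathcal A$ contains at most $r+1$ singular points of $\mathcal A$.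
   Context: All arrangements are essential (the lines do not all pass through one point) arrangements of pairwise distinct lines in $\mathbb P^2_{\mathbb C}$. Let $\mathcal A\colon f=0$ be an arrangement of $d$ lines, $f\in S=\mathbb C[x,y,z]$ being the product of the $d$ linear forms. Put $D_0(f)=\{(a,b,c)\in S^3: af_x+bf_y+cf_z=0\}$, and let $r(\mathcal A)$ be the minimal degree of a nonzero element of $D_0(f)$. A singular point of $\mathcal A$ is a point lying on at least two lines; its multiplicity is the number of lines through it; $m(\mathcal A)$ is the maximal multiplicity, and $r_L$ is the number of singular points of $\mathcal A$ on the line $L\in\mathcal A$. $\mathcal L(\mathcal A)$ denotes the intersection lattice (an isomorphism is a bijection between the lines under which sets of concurrent lines correspond to sets of concurrent lines). A counterexample is a pair $(\mathcal A,\mathcal A')$ of arrangements of $d$ lines with $\mathcal L(\mathcal A)\cong\mathcal L(\mathcal A')$, $r(\mathcal A)<\frac{d-2}{2}$ and $r(\mathcal A)<r(\mathcal A')$. For such a pair an isomorphism of lattices is fixed, and $L'\in\mathcal A'$ denotes the line corresponding to $L\in\mathcal A$. *)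

theory Defs
  imports "HOL-Analysis.Analysis" "HOL-Library.Poly_Mapping"
begin

text \<open>
  The polynomial ring \<open>S = \<complex>[x, y, z]\<close>: finitely supported families of coefficients indexed by
  exponent vectors. The three variables are indexed by the elements of the type \<open>3\<close>.
\<close>

type_synonym S = "(3 \<Rightarrow>\<^sub>0 nat) \<Rightarrow>\<^sub>0 complex"

definition partial_deriv :: "3 \<Rightarrow> S \<Rightarrow> S" where
  "partial_deriv i p =
     (\<Sum>e\<in>Poly_Mapping.keys p.
        Poly_Mapping.single (e - Poly_Mapping.single i 1)
          (of_nat (Poly_Mapping.lookup e i) * Poly_Mapping.lookup p e))"

definition homogeneous :: "nat \<Rightarrow> S \<Rightarrow> bool" where
  "homogeneous k p \<longleftrightarrow>
     (\<forall>e\<in>Poly_Mapping.keys p. (\<Sum>i\<in>UNIV. Poly_Mapping.lookup e i) = k)"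

definition linear_form :: "complex ^ 3 \<Rightarrow> S" where
  "linear_form c = (\<Sum>i\<in>UNIV. Poly_Mapping.single (Poly_Mapping.single i 1) (c $ i))"

text \<open>
  Points and lines of \<open>\<P>\<^sup>2\<close> over the complex numbers are encoded by their cones in \<open>\<complex>\<^sup>3\<close>: a point is
  a linear subspace of dimension one, a line is the zero locus of a nonzero linear form, and the
  point \<open>P\<close> lies on the line \<open>L\<close> iff \<open>P \<subseteq> L\<close>.
\<close>

definition proj_points :: "(complex ^ 3) set set" where
  "proj_points = {vec.span {v} | v. v \<noteq> 0}"

definition zero_locus :: "complex ^ 3 \<Rightarrow> (complex ^ 3) set" where
  "zero_locus c = {v. (\<Sum>i\<in>UNIV. c $ i * v $ i) = 0}"

definition proj_lines :: "(complex ^ 3) set set" where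
  "proj_lines = {zero_locus c | c. c \<noteq> 0}"

definition concurrent :: "(complex ^ 3) set set \<Rightarrow> bool" where
  "concurrent X \<longleftrightarrow> (\<exists>P\<in>proj_points. \<forall>L\<in>X. P \<subseteq> L)"

definition arrangement :: "(complex ^ 3) set set \<Rightarrow> bool" where
  "arrangement A \<longleftrightarrow> finite A \<and> A \<subseteq> proj_lines \<and> \<not> concurrent A"

text \<open>
  The coefficients of a linear form defining \<open>L\<close> are unique up to a nonzero scalar. Another choice
  multiplies the defining polynomial of an arrangement by a nonzero constant, which does not
  affect \<open>D0\<close>.
\<close>

definition line_coeffs :: "(complex ^ 3) set \<Rightarrow> complex ^ 3" where
  "line_coeffs L = (SOME c. c \<noteq> 0 \<and> L = zero_locus c)"

lemma line_coeffs:
  assumes "L \<in> proj_lines"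
  shows "line_coeffs L \<noteq> 0 \<and> L = zero_locus (line_coeffs L)"
proof -
  have "\<exists>c. c \<noteq> 0 \<and> L = zero_locus c"
    using assms by (auto simp: proj_lines_def)
  then show ?thesis
    unfolding line_coeffs_def by (rule someI_ex)
qed

definition defining_poly :: "(complex ^ 3) set set \<Rightarrow> S" where
  "defining_poly A = (\<Prod>L\<in>A. linear_form (line_coeffs L))"

definition D0 :: "S \<Rightarrow> (S ^ 3) set" where
  "D0 f = {\<theta>. (\<Sum>i\<in>UNIV. \<theta> $ i * partial_deriv i f) = 0}"

text \<open>
  \<open>D0 f\<close> is graded for homogeneous \<open>f\<close>; an element has degree \<open>k\<close> when its three components are
  homogeneous of degree \<open>k\<close>.
\<close>

definition min_deg :: "(complex ^ 3) set set \<Rightarrow> nat" where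
  "min_deg A =
     (LEAST k. \<exists>\<theta>\<in>D0 (defining_poly A). \<theta> \<noteq> 0 \<and> (\<forall>i. homogeneous k (\<theta> $ i)))"

definition multiplicity_at :: "(complex ^ 3) set set \<Rightarrow> (complex ^ 3) set \<Rightarrow> nat" where
  "multiplicity_at A P = card {L \<in> A. P \<subseteq> L}"

definition singular_points :: "(complex ^ 3) set set \<Rightarrow> (complex ^ 3) set set" where
  "singular_points A = {P \<in> proj_points. multiplicity_at A P \<ge> 2}"

text \<open>
  An arrangement of at least two lines has a singular point, so that the maximum is then taken
  over a nonempty set.
\<close>

definition max_multiplicity :: "(complex ^ 3) set set \<Rightarrow> nat" where
  "max_multiplicity A = Max (multiplicity_at A ` singular_points A)"

definition num_singular_on :: "(complex ^ 3) set set \<Rightarrow> (complex ^ 3) set \<Rightarrow> nat" where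
  "num_singular_on A L = card {P \<in> singular_points A. P \<subseteq> L}"

definition lattice_iso ::
  "((complex ^ 3) set \<Rightarrow> (complex ^ 3) set) \<Rightarrow>
     (complex ^ 3) set set \<Rightarrow> (complex ^ 3) set set \<Rightarrow> bool" where
  "lattice_iso \<phi> A A' \<longleftrightarrow>
     bij_betw \<phi> A A' \<and> (\<forall>X. X \<subseteq> A \<longrightarrow> concurrent X = concurrent (\<phi> ` X))"

definition counterexample ::
  "nat \<Rightarrow> (complex ^ 3) set set \<Rightarrow> (complex ^ 3) set set \<Rightarrow> bool" where
  "counterexample d A A' \<longleftrightarrow>
     arrangement A \<and> arrangement A' \<and> card A = d \<and> card A' = d \<and>
     (\<exists>\<phi>. lattice_iso \<phi> A A') \<and>
     real (min_deg A) < (real d - 2) / 2 \<and> min_deg A < min_deg A'"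

end

theory Submission imports Defs begin

text \<open>
  Let \<open>f = \<ell> g\<close>, where \<open>\<ell>\<close> defines \<open>L\<close> and \<open>g\<close> defines \<open>B\<close>, and let \<open>E\<close> be the Euler field. A syzygy
  \<open>\<delta>\<close> of \<open>g\<close> yields the syzygy \<open>d \<ell> \<delta> - \<delta>(\<ell>) E\<close> of \<open>f\<close>; a syzygy \<open>\<theta>\<close> of \<open>f\<close> has \<open>\<theta>(\<ell>) = \<ell> h\<close> and yields
  the syzygy \<open>(d - 1) \<theta> + h E\<close> of \<open>g\<close>. This bounds the degrees under removal of a line.
  A syzygy \<open>\<delta>\<close> of \<open>g\<close> of degree \<open>r\<close> obtained in the second way is tangent to \<open>L\<close> and is parallel to \<open>E\<close>
  at every singular point on \<open>L\<close>. If there are more than \<open>r + 1\<close> of these, then the minors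
  of \<open>(\<delta>, E)\<close>, of degree \<open>r + 1\<close>, vanish on \<open>L\<close>, so \<open>\<delta>\<close> is a multiple of \<open>E\<close> modulo \<open>\<ell>\<close>. Applying \<open>\<delta>\<close>
  to \<open>g\<close> shows that the factor is divisible by \<open>\<ell>\<close>, so \<open>\<delta> / \<ell>\<close> is a syzygy of \<open>g\<close> of degree \<open>r - 1\<close>.
\<close>

section \<open>Substitution homomorphisms\<close>

lemma S_as_sum: "p = (\<Sum>e\<in>Poly_Mapping.keys p. Poly_Mapping.single e (Poly_Mapping.lookup p e))"
  for p :: S
  by (rule poly_mapping_eqI)
    (auto simp: lookup_sum lookup_single when_def in_keys_iff)

lemma S_induct [case_names single add]:
  fixes p :: S
  assumes single: "\<And>e c. P (Poly_Mapping.single e c)"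
    and add: "\<And>p q. P p \<Longrightarrow> P q \<Longrightarrow> P (p + q)"
  shows "P p"
proof -
  have zero: "P 0"
    using single[of 0 0] by simp
  have "P (\<Sum>e\<in>K. Poly_Mapping.single e (Poly_Mapping.lookup p e))" if "finite K" for K
    using that by (induction K) (auto intro: zero single add)
  from this[of "Poly_Mapping.keys p"] show ?thesis
    by (simp flip: S_as_sum)
qed

definition Const :: "complex \<Rightarrow> S" where
  "Const c = Poly_Mapping.single 0 c"

definition Var :: "3 \<Rightarrow> S" where
  "Var i = Poly_Mapping.single (Poly_Mapping.single i 1) 1"

lemma Const_simps [simp]:
  "Const 0 = 0" "Const 1 = 1"
  "Const (a + b) = Const a + Const b" "Const (a - b) = Const a - Const b"
  "Const (- a) = - Const a" "Const (a * b) = Const a * Const b"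
  "Const (a ^ k) = Const a ^ k" "Const (of_nat n) = of_nat n"
  "Const a = Const b \<longleftrightarrow> a = b"
proof -
  show mult: "Const (a * b) = Const a * Const b" for a b
    by (simp add: Const_def mult_single)
  show one: "Const 1 = 1"
    by (simp add: Const_def)
  show "Const (a ^ k) = Const a ^ k"
    by (induction k) (simp_all add: mult one)
  show "Const a = Const b \<longleftrightarrow> a = b"
    by (metis Const_def lookup_single_eq)
qed (simp_all add: Const_def single_add single_diff single_uminus)

lemma Const_eq_0_iff [simp]: "Const a = 0 \<longleftrightarrow> a = 0"
  using Const_simps(9)[of a 0] by simp

lemma Const_sum: "Const (sum f I) = (\<Sum>i\<in>I. Const (f i))"
  by (induction I rule: infinite_finite_induct) auto

lemma Const_mult_single: "Const a * Poly_Mapping.single e b = Poly_Mapping.single e (a * b)"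
  by (simp add: Const_def mult_single)

lemma linear_form_eq: "linear_form c = (\<Sum>i\<in>UNIV. Const (c $ i) * Var i)"
  by (simp add: linear_form_def Var_def Const_mult_single)

text \<open>The evaluation homomorphism from S to S. Constant images give evaluation at a point,
  \<open>elim\<close> gives restriction to a line, and images proportional to a fixed vector give
  restriction to the cone over a point.\<close>

definition subst :: "(3 \<Rightarrow> S) \<Rightarrow> S \<Rightarrow> S" where
  "subst \<sigma> p =
     (\<Sum>e\<in>Poly_Mapping.keys p.
        Const (Poly_Mapping.lookup p e) * (\<Prod>i\<in>UNIV. \<sigma> i ^ Poly_Mapping.lookup e i))"

text \<open>A common index set lets the expansions of \<open>p\<close>, \<open>q\<close> and
  \<open>p + q\<close> be compared term by term.\<close>

lemma subst_superset:
  assumes "finite K" "Poly_Mapping.keys p \<subseteq> K"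
  shows "subst \<sigma> p =
    (\<Sum>e\<in>K. Const (Poly_Mapping.lookup p e) * (\<Prod>i\<in>UNIV. \<sigma> i ^ Poly_Mapping.lookup e i))"
  unfolding subst_def using assms
  by (intro sum.mono_neutral_left) (auto simp: in_keys_iff)

lemma subst_add [simp]: "subst \<sigma> (p + q) = subst \<sigma> p + subst \<sigma> q"
proof -
  let ?K = "Poly_Mapping.keys p \<union> Poly_Mapping.keys q"
  have "Poly_Mapping.keys (p + q) \<subseteq> ?K"
    by (rule keys_add)
  then show ?thesis
    using subst_superset[of ?K p \<sigma>] subst_superset[of ?K q \<sigma>] subst_superset[of ?K "p + q" \<sigma>]
    by (simp add: lookup_add sum.distrib distrib_right)
qed

lemma subst_single:
  "subst \<sigma> (Poly_Mapping.single e c) = Const c * (\<Prod>i\<in>UNIV. \<sigma> i ^ Poly_Mapping.lookup e i)"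
  using subst_superset[of "{e}" "Poly_Mapping.single e c" \<sigma>] by simp

lemma subst_mult [simp]: "subst \<sigma> (p * q) = subst \<sigma> p * subst \<sigma> q"
proof (induction p rule: S_induct)
  case (single e c)
  show ?case
    by (induction q rule: S_induct)
      (simp_all add: distrib_left mult_single subst_single lookup_add power_add prod.distrib
        mult.assoc mult.left_commute)
qed (simp add: distrib_right)

lemma subst_Const [simp]: "subst \<sigma> (Const c) = Const c"
  unfolding Const_def by (simp add: subst_single) (simp add: Const_def)

lemma subst_Var [simp]: "subst \<sigma> (Var j) = \<sigma> j"
proof -
  have "(\<Prod>i\<in>UNIV. \<sigma> i ^ Poly_Mapping.lookup (Poly_Mapping.single j (1 :: nat)) i)
      = (\<Prod>i\<in>UNIV. if i = j then \<sigma> j else 1)"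
    by (rule prod.cong) (auto simp: lookup_single when_def)
  then show ?thesis
    by (simp add: Var_def subst_single)
qed

lemma subst_0 [simp]: "subst \<sigma> 0 = 0"
  using subst_Const[of \<sigma> 0] by (simp del: subst_Const)

lemma subst_1 [simp]: "subst \<sigma> 1 = 1"
  using subst_Const[of \<sigma> 1] by (simp del: subst_Const)

lemma subst_uminus [simp]: "subst \<sigma> (- p) = - subst \<sigma> p"
  using subst_add[of \<sigma> p "- p"] by (simp del: subst_add add: eq_neg_iff_add_eq_0 add.commute)

lemma subst_diff [simp]: "subst \<sigma> (p - q) = subst \<sigma> p - subst \<sigma> q"
  using subst_add[of \<sigma> p "- q"] by (simp del: subst_add)

lemma subst_sum [simp]: "subst \<sigma> (sum f I) = (\<Sum>i\<in>I. subst \<sigma> (f i))"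
  by (induction I rule: infinite_finite_induct) auto

text \<open>Every monomial of degree \<open>k\<close> picks up the factor \<open>a ^ k\<close>. With
  constant \<open>\<sigma>\<close>, restricting a form to the cone over a point thus reduces to
  evaluating it at the point.\<close>

lemma subst_scaled_homogeneous:
  assumes "homogeneous k p"
  shows "subst (\<lambda>i. a * \<sigma> i) p = a ^ k * subst \<sigma> p"
  unfolding subst_def sum_distrib_left
proof (rule sum.cong)
  fix e assume "e \<in> Poly_Mapping.keys p"
  then have "(\<Sum>i\<in>UNIV. Poly_Mapping.lookup e i) = k"
    using assms by (simp add: homogeneous_def)
  then have "(\<Prod>i\<in>UNIV. (a * \<sigma> i) ^ Poly_Mapping.lookup e i)
      = a ^ k * (\<Prod>i\<in>UNIV. \<sigma> i ^ Poly_Mapping.lookup e i)"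
    by (simp add: power_mult_distrib prod.distrib flip: power_sum)
  then show "Const (Poly_Mapping.lookup p e) * (\<Prod>i\<in>UNIV. (a * \<sigma> i) ^ Poly_Mapping.lookup e i)
      = a ^ k * (Const (Poly_Mapping.lookup p e) * (\<Prod>i\<in>UNIV. \<sigma> i ^ Poly_Mapping.lookup e i))"
    by (simp add: mult.left_commute)
qed simp

lemma single_eq_prod_Var:
  "Poly_Mapping.single e c = Const c * (\<Prod>i\<in>UNIV. Var i ^ Poly_Mapping.lookup e i)"
proof -
  have pow: "Var i ^ n = Poly_Mapping.single (Poly_Mapping.single i n) 1" for i n
    by (induction n) (simp_all add: Var_def mult_single flip: single_add)
  have prod: "(\<Prod>i\<in>I. Poly_Mapping.single (g i) (1 :: complex))
      = Poly_Mapping.single (sum g I) 1" if "finite I"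
    for I :: "3 set" and g :: "3 \<Rightarrow> 3 \<Rightarrow>\<^sub>0 nat"
    using that by (induction I) (simp_all add: mult_single)
  have "(\<Sum>i\<in>UNIV. Poly_Mapping.single i (Poly_Mapping.lookup e i)) = e"
    by (rule poly_mapping_eqI) (simp add: lookup_sum lookup_single when_def)
  then show ?thesis
    by (simp add: pow prod Const_mult_single)
qed

lemma S_alg_induct [case_names Const Var add mult]:
  fixes p :: S
  assumes Const: "\<And>c. P (Const c)"
    and Var: "\<And>i. P (Var i)"
    and add: "\<And>p q. P p \<Longrightarrow> P q \<Longrightarrow> P (p + q)"
    and mult: "\<And>p q. P p \<Longrightarrow> P q \<Longrightarrow> P (p * q)"
  shows "P p"
proof (induction p rule: S_induct)
  case (single e c)
  have one: "P 1"
    using Const[of 1] by simp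
  have pow: "P (Var i ^ n)" for i n
    by (induction n) (auto intro: one Var mult)
  have "P (\<Prod>i\<in>I. Var i ^ Poly_Mapping.lookup e i)" if "finite I" for I
    using that by (induction I) (auto intro: one pow mult)
  then show ?case
    by (simp add: single_eq_prod_Var Const mult)
qed (rule add)

text \<open>Modulo the ideal \<open>I\<close> the substitution agrees with the identity on constants
  and variables, hence on all of S.\<close>

lemma subst_cong_ideal:
  assumes zero: "0 \<in> I"
    and add: "\<And>a b. a \<in> I \<Longrightarrow> b \<in> I \<Longrightarrow> a + b \<in> I"
    and mult: "\<And>a b. a \<in> I \<Longrightarrow> b * a \<in> I"
    and Var: "\<And>i. Var i - \<sigma> i \<in> I"
  shows "p - subst \<sigma> p \<in> I"
proof (induction p rule: S_alg_induct)
  case (add p q)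
  have "p + q - subst \<sigma> (p + q) = (p - subst \<sigma> p) + (q - subst \<sigma> q)"
    by simp
  then show ?case
    using assms(2)[OF add] by metis
next
  case (mult p q)
  have "p * q - subst \<sigma> (p * q) = q * (p - subst \<sigma> p) + subst \<sigma> p * (q - subst \<sigma> q)"
    by (simp add: algebra_simps)
  then show ?case
    using assms(2)[OF assms(3)[OF mult(1)] assms(3)[OF mult(2)]] by metis
qed (use zero Var in auto)

section \<open>Homogeneous polynomials\<close>

lemma homogeneous_0 [simp]: "homogeneous k 0"
  by (simp add: homogeneous_def)

lemma homogeneous_add: "homogeneous k p \<Longrightarrow> homogeneous k q \<Longrightarrow> homogeneous k (p + q)"
  using keys_add[of p q] unfolding homogeneous_def by blast

lemma homogeneous_uminus: "homogeneous k p \<Longrightarrow> homogeneous k (- p)"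
  unfolding homogeneous_def by (simp add: in_keys_iff)

lemma homogeneous_diff: "homogeneous k p \<Longrightarrow> homogeneous k q \<Longrightarrow> homogeneous k (p - q)"
  using homogeneous_add[of k p "- q"] homogeneous_uminus[of k q] by simp

lemma homogeneous_sum: "(\<And>i. i \<in> I \<Longrightarrow> homogeneous k (f i)) \<Longrightarrow> homogeneous k (sum f I)"
  by (induction I rule: infinite_finite_induct) (auto intro: homogeneous_add)

lemma homogeneous_mult:
  assumes "homogeneous k p" "homogeneous l q"
  shows "homogeneous (k + l) (p * q)"
  unfolding homogeneous_def
proof
  fix e assume "e \<in> Poly_Mapping.keys (p * q)"
  then obtain a b where "e = a + b" "a \<in> Poly_Mapping.keys p" "b \<in> Poly_Mapping.keys q"
    using keys_mult[of p q] by auto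
  then show "(\<Sum>i\<in>UNIV. Poly_Mapping.lookup e i) = k + l"
    using assms by (auto simp: homogeneous_def lookup_add sum.distrib)
qed

lemma homogeneous_Const [simp]: "homogeneous 0 (Const c)"
  by (simp add: homogeneous_def Const_def)

lemma homogeneous_Const_mult: "homogeneous k p \<Longrightarrow> homogeneous k (Const c * p)"
  using homogeneous_mult[OF homogeneous_Const[of c], of k p] by simp

lemma homogeneous_Var [simp]: "homogeneous 1 (Var i)"
  by (simp add: homogeneous_def Var_def lookup_single when_def)

lemma homogeneous_linear_form [simp]: "homogeneous 1 (linear_form c)"
  unfolding linear_form_eq by (intro homogeneous_sum homogeneous_Const_mult homogeneous_Var)

lemma homogeneous_0_Const:
  assumes "homogeneous 0 p"
  obtains c where "p = Const c"
proof
  have keys: "Poly_Mapping.keys p \<subseteq> {0}"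
    using assms by (auto simp: homogeneous_def intro!: poly_mapping_eqI)
  show "p = Const (Poly_Mapping.lookup p 0)"
    using keys by (intro poly_mapping_eqI) (auto simp: Const_def lookup_single when_def in_keys_iff)
qed

section \<open>Graded components\<close>

definition hcomp :: "nat \<Rightarrow> S \<Rightarrow> S" where
  "hcomp k p =
     (\<Sum>e | e \<in> Poly_Mapping.keys p \<and> (\<Sum>i\<in>UNIV. Poly_Mapping.lookup e i) = k.
        Poly_Mapping.single e (Poly_Mapping.lookup p e))"

lemma lookup_hcomp:
  "Poly_Mapping.lookup (hcomp k p) e =
     (if (\<Sum>i\<in>UNIV. Poly_Mapping.lookup e i) = k then Poly_Mapping.lookup p e else 0)"
  by (simp add: hcomp_def lookup_sum lookup_single when_def in_keys_iff)

lemma homogeneous_hcomp [simp]: "homogeneous k (hcomp k p)"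
  by (auto simp: homogeneous_def in_keys_iff lookup_hcomp split: if_splits)

lemma hcomp_homogeneous: "homogeneous k p \<Longrightarrow> hcomp k p = p"
  by (rule poly_mapping_eqI) (auto simp: lookup_hcomp homogeneous_def in_keys_iff)

lemma hcomp_add: "hcomp k (p + q) = hcomp k p + hcomp k q"
  by (rule poly_mapping_eqI) (simp add: lookup_hcomp lookup_add)

lemma hcomp_single:
  "hcomp k (Poly_Mapping.single e c) =
     (if (\<Sum>i\<in>UNIV. Poly_Mapping.lookup e i) = k then Poly_Mapping.single e c else 0)"
  by (rule poly_mapping_eqI) (auto simp: lookup_hcomp lookup_single when_def)

lemma hcomp_0 [simp]: "hcomp k 0 = 0"
  by (rule poly_mapping_eqI) (simp add: lookup_hcomp)

lemma hcomp_Const_Var_mult: "hcomp (Suc k) (Const c * Var i * p) = Const c * Var i * hcomp k p"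
proof (induction p rule: S_induct)
  case (single e b)
  have "(\<Sum>j\<in>UNIV. Poly_Mapping.lookup (Poly_Mapping.single i 1 + e) j)
      = Suc (\<Sum>j\<in>UNIV. Poly_Mapping.lookup e j)"
    by (simp add: lookup_add sum.distrib lookup_single when_def)
  then show ?case
    by (simp add: Var_def Const_mult_single mult_single hcomp_single)
qed (simp add: distrib_left hcomp_add)

text \<open>Multiplication by a linear form raises degrees by exactly one. Cofactors produced by a
  divisibility carry no degree information; this allows replacing them by their component of the
  expected degree.\<close>

lemma hcomp_linear_form_mult: "hcomp (Suc k) (linear_form c * p) = linear_form c * hcomp k p"
  by (simp add: linear_form_eq sum_3 distrib_right hcomp_add hcomp_Const_Var_mult)

section \<open>Derivations\<close>

lemma partial_deriv_superset:
  assumes "finite K" "Poly_Mapping.keys p \<subseteq> K"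
  shows "partial_deriv i p =
    (\<Sum>e\<in>K. Poly_Mapping.single (e - Poly_Mapping.single i 1)
      (of_nat (Poly_Mapping.lookup e i) * Poly_Mapping.lookup p e))"
  unfolding partial_deriv_def using assms
  by (intro sum.mono_neutral_left) (auto simp: in_keys_iff)

lemma partial_deriv_add: "partial_deriv i (p + q) = partial_deriv i p + partial_deriv i q"
proof -
  let ?K = "Poly_Mapping.keys p \<union> Poly_Mapping.keys q"
  have "Poly_Mapping.keys (p + q) \<subseteq> ?K"
    by (rule keys_add)
  then show ?thesis
    using partial_deriv_superset[of ?K p i] partial_deriv_superset[of ?K q i]
      partial_deriv_superset[of ?K "p + q" i]
    by (simp add: lookup_add distrib_left single_add sum.distrib)
qed

lemma partial_deriv_single:
  "partial_deriv i (Poly_Mapping.single e c) =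
     Poly_Mapping.single (e - Poly_Mapping.single i 1) (of_nat (Poly_Mapping.lookup e i) * c)"
  using partial_deriv_superset[of "{e}" "Poly_Mapping.single e c" i] by simp

lemma partial_deriv_mult:
  "partial_deriv i (p * q) = partial_deriv i p * q + p * partial_deriv i q"
proof (induction p rule: S_induct)
  case (single e c)
  show ?case
  proof (induction q rule: S_induct)
    case (single e' c')
    \<comment> \<open>Subtraction of exponents is truncated, so it commutes with addition only where
      the exponent is positive. Otherwise the coefficient of the monomial is zero and its exponent
      is irrelevant.\<close>
    have shift: "a - Poly_Mapping.single i 1 + b = a + b - Poly_Mapping.single i 1"
      if "Poly_Mapping.lookup a i \<noteq> 0" for a b :: "3 \<Rightarrow>\<^sub>0 nat"
      using that by (intro poly_mapping_eqI) (auto simp: lookup_add lookup_minus lookup_single when_def)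
    have 1: "Poly_Mapping.single (e - Poly_Mapping.single i 1 + e')
          (of_nat (Poly_Mapping.lookup e i) * c * c')
        = Poly_Mapping.single (e + e' - Poly_Mapping.single i 1)
          (of_nat (Poly_Mapping.lookup e i) * c * c')"
      using shift[of e e'] by (cases "Poly_Mapping.lookup e i = 0") simp_all
    have 2: "Poly_Mapping.single (e + (e' - Poly_Mapping.single i 1))
          (c * (of_nat (Poly_Mapping.lookup e' i) * c'))
        = Poly_Mapping.single (e + e' - Poly_Mapping.single i 1)
          (c * (of_nat (Poly_Mapping.lookup e' i) * c'))"
      using shift[of e' e]
      by (cases "Poly_Mapping.lookup e' i = 0") (simp_all add: add.commute)
    show ?case
      unfolding mult_single partial_deriv_single 1 2
      by (simp add: lookup_add distrib_left distrib_right mult.left_commute mult.assoc flip: single_add)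
  qed (simp add: distrib_left partial_deriv_add)
qed (simp add: distrib_right partial_deriv_add)

lemma partial_deriv_Const [simp]: "partial_deriv i (Const c) = 0"
  by (simp add: Const_def partial_deriv_single)

lemma partial_deriv_Var: "partial_deriv i (Var j) = (if i = j then 1 else 0)"
  by (simp add: Var_def partial_deriv_single lookup_single)

lemma homogeneous_partial_deriv:
  assumes "homogeneous k p"
  shows "homogeneous (k - 1) (partial_deriv i p)"
  unfolding partial_deriv_def
proof (rule homogeneous_sum)
  fix e assume "e \<in> Poly_Mapping.keys p"
  then have deg: "(\<Sum>j\<in>UNIV. Poly_Mapping.lookup e j) = k"
    using assms by (simp add: homogeneous_def)
  show "homogeneous (k - 1) (Poly_Mapping.single (e - Poly_Mapping.single i 1)
      (of_nat (Poly_Mapping.lookup e i) * Poly_Mapping.lookup p e))"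
  \<comment> \<open>With exponent zero the coefficient vanishes; this also covers
    \<open>k = 0\<close>, where \<open>k - 1\<close> is truncated.\<close>
  proof (cases "Poly_Mapping.lookup e i = 0")
    case False
    have "(\<Sum>j\<in>UNIV. Poly_Mapping.lookup (e - Poly_Mapping.single i 1) j)
        = (\<Sum>j\<in>UNIV. Poly_Mapping.lookup e j)
          - (\<Sum>j\<in>UNIV. Poly_Mapping.lookup (Poly_Mapping.single i (1 :: nat)) j)"
      unfolding lookup_minus using False
      by (intro sum_subtractf_nat) (auto simp: lookup_single when_def)
    then show ?thesis
      using deg by (simp add: homogeneous_def lookup_single when_def)
  qed simp
qed

section \<open>Vector fields acting on polynomials\<close>

definition deriv_along :: "S ^ 3 \<Rightarrow> S \<Rightarrow> S" where
  "deriv_along \<theta> p = (\<Sum>i\<in>UNIV. \<theta> $ i * partial_deriv i p)"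

definition euler :: "S ^ 3" where
  "euler = (\<chi> i. Var i)"

lemma euler_nth [simp]: "euler $ i = Var i"
  by (simp add: euler_def)

lemma D0_iff: "\<theta> \<in> D0 f \<longleftrightarrow> deriv_along \<theta> f = 0"
  by (simp add: D0_def deriv_along_def)

lemma deriv_along_mult:
  "deriv_along \<theta> (p * q) = deriv_along \<theta> p * q + p * deriv_along \<theta> q"
  by (simp add: deriv_along_def partial_deriv_mult distrib_left sum.distrib
      sum_distrib_left sum_distrib_right algebra_simps)

lemma deriv_along_combination:
  "deriv_along (\<chi> i. a * \<theta> $ i + b * \<eta> $ i) p = a * deriv_along \<theta> p + b * deriv_along \<eta> p"
  by (simp add: deriv_along_def algebra_simps sum.distrib sum_distrib_left)

lemma deriv_along_linear_form:
  "deriv_along \<theta> (linear_form c) = (\<Sum>i\<in>UNIV. Const (c $ i) * \<theta> $ i)"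
  by (simp add: deriv_along_def linear_form_eq sum_3 partial_deriv_add partial_deriv_mult
      partial_deriv_Var)

lemma deriv_along_1 [simp]: "deriv_along \<theta> 1 = 0"
  using partial_deriv_Const[of _ 1] by (simp add: deriv_along_def del: partial_deriv_Const)

lemma euler_linear_form: "deriv_along euler (linear_form c) = linear_form c"
  unfolding deriv_along_linear_form by (simp add: linear_form_eq)

lemma defining_poly_remove:
  assumes "finite A" "L \<in> A"
  shows "defining_poly A = linear_form (line_coeffs L) * defining_poly (A - {L})"
  using assms by (simp add: defining_poly_def prod.remove)

text \<open>Linear forms are eigenvectors of the Euler field with eigenvalue 1, and by the product
  rule eigenvalues add up over the factors.\<close>

lemma euler_defining_poly:
  assumes "finite A"
  shows "deriv_along euler (defining_poly A) = of_nat (card A) * defining_poly A"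
  using assms
  by (induction A)
    (simp_all add: defining_poly_def deriv_along_mult euler_linear_form algebra_simps)

lemma homogeneous_defining_poly:
  assumes "finite A"
  shows "homogeneous (card A) (defining_poly A)"
  using assms
proof (induction A)
  case empty
  then show ?case
    using homogeneous_Const[of 1] by (simp add: defining_poly_def del: homogeneous_Const)
next
  case (insert L A)
  then show ?case
    using homogeneous_mult[OF homogeneous_linear_form]
    by (fastforce simp: defining_poly_def)
qed

section \<open>Linear forms\<close>

lemma linear_form_combination:
  "linear_form (a *s v + b *s w) = Const a * linear_form v + Const b * linear_form w"
  by (simp add: linear_form_eq sum_3 algebra_simps)

lemma linear_form_axis: "linear_form (axis i 1) = Var i"
  using exhaust_3[of i] by (auto simp: linear_form_eq sum_3 axis_def)

abbreviation eval_at :: "complex ^ 3 \<Rightarrow> S \<Rightarrow> S" where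
  "eval_at v \<equiv> subst (\<lambda>i. Const (v $ i))"

lemma eval_at_linear_form:
  "eval_at v (linear_form c) = Const (\<Sum>i\<in>UNIV. c $ i * v $ i)"
  by (simp add: linear_form_eq Const_sum)

lemma eval_at_linear_form_eq_0_iff [simp]:
  "eval_at v (linear_form c) = 0 \<longleftrightarrow> v \<in> zero_locus c"
  by (simp only: eval_at_linear_form Const_eq_0_iff zero_locus_def mem_Collect_eq)

text \<open>Solves \<open>c = 0\<close> for the variable \<open>k\<close>, so that the kernel of the substitution is \<open>(c)\<close>.\<close>

definition elim :: "complex ^ 3 \<Rightarrow> 3 \<Rightarrow> 3 \<Rightarrow> S" where
  "elim c k i = (if i = k then Var k - Const (1 / c $ k) * linear_form c else Var i)"

lemma elim_linear_form:
  assumes "c $ k \<noteq> 0"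
  shows "subst (elim c k) (linear_form c) = 0"
proof -
  have "subst (elim c k) (linear_form c)
      = (\<Sum>i\<in>UNIV. Const (c $ i) * Var i - (if i = k then linear_form c else 0))"
    unfolding linear_form_eq[of c] subst_sum
  proof (rule sum.cong)
    fix i
    have "Const (c $ k) * Const (1 / c $ k) = 1"
      using assms by (simp flip: Const_simps(6))
    then show "subst (elim c k) (Const (c $ i) * Var i)
      = Const (c $ i) * Var i - (if i = k then \<Sum>i\<in>UNIV. Const (c $ i) * Var i else 0)"
      by (auto simp: elim_def right_diff_distrib linear_form_eq simp flip: mult.assoc)
  qed simp
  also have "\<dots> = 0"
    by (simp add: sum_subtractf linear_form_eq)
  finally show ?thesis .
qed

lemma elim_cong: "linear_form c dvd p - subst (elim c k) p"
  using subst_cong_ideal[where I = "{p. linear_form c dvd p}" and \<sigma> = "elim c k" and p = p]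
  by (simp add: elim_def)

text \<open>The substitution kills the linear form, and it changes a polynomial only by multiples of
  that form.\<close>

lemma linear_form_dvd_iff:
  assumes "c $ k \<noteq> 0"
  shows "linear_form c dvd p \<longleftrightarrow> subst (elim c k) p = 0"
proof
  assume "linear_form c dvd p"
  then show "subst (elim c k) p = 0"
    by (auto simp: elim_linear_form[OF assms])
next
  assume "subst (elim c k) p = 0"
  then show "linear_form c dvd p"
    using elim_cong[of c p k] by simp
qed

lemma vec3_nonzeroE:
  fixes c :: "'a :: zero ^ 3"
  assumes "c \<noteq> 0"
  obtains k where "c $ k \<noteq> 0"
  using assms by (auto simp: vec_eq_iff)

lemma linear_form_nonzero:
  assumes "c \<noteq> 0"
  shows "linear_form c \<noteq> 0"
proof
  assume "linear_form c = 0"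
  obtain k where "c $ k \<noteq> 0"
    using assms by (rule vec3_nonzeroE)
  moreover have "eval_at (axis k 1) (linear_form c) = Const (c $ k)"
    unfolding eval_at_linear_form by (simp add: axis_def if_distrib cong: if_cong)
  ultimately show False
    using \<open>linear_form c = 0\<close> by simp
qed

text \<open>The ideal of the linear form is the kernel of a homomorphism into an integral
  domain.\<close>

lemma prime_elem_linear_form:
  assumes "c \<noteq> 0"
  shows "prime_elem (linear_form c)"
proof -
  obtain k where k: "c $ k \<noteq> 0"
    using assms by (rule vec3_nonzeroE)
  show ?thesis
    by (rule prime_elemI) (use linear_form_nonzero[OF assms] in \<open>auto simp: linear_form_dvd_iff[OF k]\<close>)
qed

lemma linear_form_dvd_Const_iff:
  assumes "c \<noteq> 0"
  shows "linear_form c dvd Const a \<longleftrightarrow> a = 0"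
  using assms by (metis Const_eq_0_iff linear_form_dvd_iff subst_Const vec3_nonzeroE)

lemma prime_elem_Var: "prime_elem (Var i)"
  using prime_elem_linear_form[of "axis i 1"] by (simp add: linear_form_axis axis_eq_0_iff)

lemma zero_locus_parallel:
  assumes "zero_locus c \<subseteq> zero_locus c'"
  shows "c $ i * c' $ j = c $ j * c' $ i"
proof (cases "i = j")
  case False
  \<comment> \<open>This vector is orthogonal to \<open>c\<close>; its pairing with
    \<open>c'\<close> is the minor that has to vanish.\<close>
  let ?v = "c $ j *s axis i 1 - c $ i *s axis j 1 :: complex ^ 3"
  have *: "(\<Sum>l\<in>UNIV. b $ l * ?v $ l) = c $ j * b $ i - c $ i * b $ j" for b
    using exhaust_3[of i] exhaust_3[of j] False by (auto simp: sum_3 axis_def)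
  have "?v \<in> zero_locus c"
    unfolding zero_locus_def mem_Collect_eq * by simp
  then have "?v \<in> zero_locus c'"
    using assms by auto
  then show ?thesis
    unfolding zero_locus_def mem_Collect_eq * by simp
qed simp

lemma zero_locus_eqI:
  assumes "c \<noteq> 0" "c' \<noteq> 0" and parallel: "\<And>i j. c $ i * c' $ j = c $ j * c' $ i"
  shows "zero_locus c = zero_locus c'"
proof -
  have sub: "zero_locus a \<subseteq> zero_locus b"
    if "a \<noteq> 0" and ab: "\<And>i j. a $ i * b $ j = a $ j * b $ i" for a b
  proof
    fix v assume "v \<in> zero_locus a"
    obtain k where k: "a $ k \<noteq> 0"
      using \<open>a \<noteq> 0\<close> by (rule vec3_nonzeroE)
    have "a $ k * (\<Sum>i\<in>UNIV. b $ i * v $ i) = (\<Sum>i\<in>UNIV. (a $ k * b $ i) * v $ i)"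
      by (simp add: sum_distrib_left mult.assoc)
    also have "\<dots> = (\<Sum>i\<in>UNIV. (a $ i * b $ k) * v $ i)"
      by (simp only: ab[of k])
    also have "\<dots> = b $ k * (\<Sum>i\<in>UNIV. a $ i * v $ i)"
      by (simp add: sum_distrib_left mult_ac)
    also have "\<dots> = 0"
      using \<open>v \<in> zero_locus a\<close> by (simp add: zero_locus_def)
    finally show "v \<in> zero_locus b"
      using k by (simp add: zero_locus_def)
  qed
  show ?thesis
    using sub[of c c'] sub[of c' c] assms by (metis mult.commute subset_antisym)
qed

text \<open>Evaluation turns divisibility into inclusion of zero loci, and the inclusion makes the
  coefficient vectors proportional.\<close>

lemma linear_form_dvd_linear_form:
  assumes "c \<noteq> 0" "c' \<noteq> 0" "linear_form c dvd linear_form c'"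
  shows "zero_locus c = zero_locus c'"
proof -
  have "zero_locus c \<subseteq> zero_locus c'"
  proof
    fix v assume "v \<in> zero_locus c"
    then have "eval_at v (linear_form c) = 0"
      by simp
    then have "eval_at v (linear_form c') = 0"
      using assms(3) by (auto simp del: eval_at_linear_form_eq_0_iff)
    then show "v \<in> zero_locus c'"
      by simp
  qed
  then show ?thesis
    using assms zero_locus_parallel zero_locus_eqI by metis
qed

lemma prime_elem_dvd_prodE:
  assumes "prime_elem p" "finite I" "p dvd prod f I"
  obtains i where "i \<in> I" "p dvd f i"
proof -
  have "\<exists>i\<in>I. p dvd f i"
    using assms(2,3)
    by (induction I)
      (use assms(1) prime_elem_not_unit in \<open>auto dest: prime_elem_dvd_multD[OF assms(1)]\<close>)
  then show ?thesis
    using that by blast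
qed

text \<open>A prime dividing the product would divide one factor, and then two lines would
  coincide.\<close>

lemma linear_form_not_dvd_defining_poly:
  assumes "finite B" "B \<subseteq> proj_lines" "L \<in> proj_lines" "L \<notin> B"
  shows "\<not> linear_form (line_coeffs L) dvd defining_poly B"
proof
  assume "linear_form (line_coeffs L) dvd defining_poly B"
  moreover have prime: "prime_elem (linear_form (line_coeffs L))"
    using line_coeffs[OF assms(3)] by (simp add: prime_elem_linear_form)
  ultimately obtain M where "M \<in> B" "linear_form (line_coeffs L) dvd linear_form (line_coeffs M)"
    using assms(1) unfolding defining_poly_def by (metis prime_elem_dvd_prodE)
  then have "L = M"
    using assms line_coeffs linear_form_dvd_linear_form by (metis subsetD)
  then show False
    using \<open>M \<in> B\<close> assms by simp
qed

lemma defining_poly_nonzero: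
  assumes "finite A" "A \<subseteq> proj_lines"
  shows "defining_poly A \<noteq> 0"
  using assms line_coeffs linear_form_nonzero by (auto simp: defining_poly_def)

section \<open>Polynomials restricted to a line\<close>

text \<open>Allows coordinates to be named by their role, such as a nonvanishing entry, instead of
  by the elements of type \<open>3\<close>.\<close>

lemma third_index:
  fixes j k :: 3
  assumes "j \<noteq> k"
  obtains i where "i \<noteq> j" "i \<noteq> k" "UNIV = {i, j, k}"
proof -
  have "card {j, k} < CARD(3)"
    using assms by simp
  then have "{j, k} \<noteq> UNIV"
    by (metis less_irrefl)
  then obtain i where i: "i \<notin> {j, k}"
    by blast
  then have "card {i, j, k} = CARD(3)"
    using assms by simp
  then have "{i, j, k} = UNIV"
    by (intro card_subset_eq) auto
  then show ?thesis
    using that i by auto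
qed

lemma sum_UNIV_distinct:
  fixes i j k :: 3
  assumes "i \<noteq> j" "i \<noteq> k" "j \<noteq> k" "UNIV = {i, j, k}"
  shows "sum f UNIV = f i + (f j + f k)"
proof -
  have "sum f UNIV = sum f {i, j, k}"
    using assms(4) by (rule arg_cong)
  then show ?thesis
    using assms(1-3) by simp
qed

text \<open>The forms of \<open>\<alpha>\<close> and \<open>c\<close> generate the ideal of the
  point spanned by \<open>p\<close>. Modulo that ideal \<open>q\<close> equals its restriction to
  the cone over \<open>p\<close>, and by homogeneity this restriction is a multiple of the value of
  \<open>q\<close> at \<open>p\<close>.\<close>

lemma vanishing_point_split:
  assumes c: "c \<noteq> 0" and p: "p \<noteq> 0" "p \<in> zero_locus c"
    and q: "homogeneous n q" "eval_at p q = 0"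
  obtains \<alpha> a b where
    "\<And>v. v \<in> zero_locus c \<Longrightarrow> v \<in> zero_locus \<alpha> \<longleftrightarrow> v \<in> vec.span {p}"
    "q = linear_form \<alpha> * a + linear_form c * b"
proof -
  obtain k where k: "c $ k \<noteq> 0"
    using c by (rule vec3_nonzeroE)
  \<comment> \<open>If \<open>p\<close> were supported on the coordinate \<open>k\<close> alone, the
    equation of the line and \<open>c $ k \<noteq> 0\<close> would force
    \<open>p = 0\<close>.\<close>
  obtain j where j: "j \<noteq> k" "p $ j \<noteq> 0"
  proof (rule ccontr)
    assume "\<not> thesis"
    then have 0: "p $ l = 0" if "l \<noteq> k" for l
      using that \<open>\<And>j. \<lbrakk>j \<noteq> k; p $ j \<noteq> 0\<rbrakk> \<Longrightarrow> thesis\<close> by blast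
    then have "(\<Sum>l\<in>UNIV. c $ l * p $ l) = (\<Sum>l\<in>UNIV. if l = k then c $ k * p $ k else 0)"
      by (intro sum.cong) auto
    then have "p $ k = 0"
      using p(2) k by (simp add: zero_locus_def)
    then have "p = 0"
      using 0 by (metis vec_eq_iff zero_index)
    then show False
      using p(1) by simp
  qed
  obtain i where i: "i \<noteq> j" "i \<noteq> k" and UN: "UNIV = {i, j, k}"
    using third_index[OF j(1)] by blast
  note sum3 = sum_UNIV_distinct[OF i j(1) UN]
  have ijk: "l = i \<or> l = j \<or> l = k" for l
    using UN by blast
  have cp: "c $ i * p $ i + (c $ j * p $ j + c $ k * p $ k) = 0"
    using p(2) by (simp add: zero_locus_def sum3)
  \<comment> \<open>This form vanishes at \<open>p\<close>; it is nonzero and does not involve the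
    variable \<open>k\<close>, so it is not proportional to \<open>c\<close>.\<close>
  define \<alpha> :: "complex ^ 3" where "\<alpha> = p $ j *s axis i 1 - p $ i *s axis j 1"
  define I where "I = {x. \<exists>a b. x = linear_form \<alpha> * a + linear_form c * b}"
  \<comment> \<open>The coordinates of \<open>p\<close>, rescaled so that the variable
    \<open>j\<close> is fixed: restriction to the line through the origin and
    \<open>p\<close>.\<close>
  define \<sigma> where "\<sigma> l = Const (1 / p $ j) * Var j * Const (p $ l)" for l
  have \<alpha>: "v \<in> zero_locus \<alpha> \<longleftrightarrow> p $ j * v $ i = p $ i * v $ j" for v
    using i j by (auto simp: zero_locus_def sum3 \<alpha>_def axis_def)
  have "v \<in> zero_locus \<alpha> \<longleftrightarrow> v \<in> vec.span {p}" if v: "v \<in> zero_locus c" for v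
  proof
    assume "v \<in> zero_locus \<alpha>"
    then have eq: "p $ j * v $ i = p $ i * v $ j"
      by (simp only: \<alpha>)
    obtain t where t: "t * p $ j = v $ j"
      using j(2) by (metis nonzero_divide_eq_eq)
    have "p $ j * v $ i = p $ j * (t * p $ i)"
      unfolding eq t[symmetric] by simp
    then have vi: "v $ i = t * p $ i"
      using j(2) by simp
    have "c $ i * v $ i + (c $ j * v $ j + c $ k * v $ k) = 0"
      using v by (simp add: zero_locus_def sum3)
    then have "c $ k * v $ k = t * (c $ k * p $ k)"
      unfolding vi t[symmetric] using cp by algebra
    then have "v $ k = t * p $ k"
      using k by simp
    then have "v $ l = (t *s p) $ l" for l
      using ijk[of l] vi t by auto
    then have "v = t *s p"
      by (simp add: vec_eq_iff)
    then show "v \<in> vec.span {p}"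
      unfolding vec.span_singleton by blast
  next
    assume "v \<in> vec.span {p}"
    then show "v \<in> zero_locus \<alpha>"
      by (auto simp: \<alpha> vec.span_singleton)
  qed
  moreover have "q - subst \<sigma> q \<in> I"
  proof (rule subst_cong_ideal)
    show "0 \<in> I"
      unfolding I_def by (rule CollectI, intro exI[of _ 0]) simp
    show "a + b \<in> I" if ab: "a \<in> I" "b \<in> I" for a b
    proof -
      obtain a1 a2 b1 b2 where "a = linear_form \<alpha> * a1 + linear_form c * a2"
        "b = linear_form \<alpha> * b1 + linear_form c * b2"
        using ab unfolding I_def by auto
      then have "a + b = linear_form \<alpha> * (a1 + b1) + linear_form c * (a2 + b2)"
        by (simp add: algebra_simps)
      then show ?thesis
        unfolding I_def by auto
    qed
    show "b * a \<in> I" if a: "a \<in> I" for a b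
    proof -
      obtain a1 a2 where "a = linear_form \<alpha> * a1 + linear_form c * a2"
        using a unfolding I_def by auto
      then have "b * a = linear_form \<alpha> * (b * a1) + linear_form c * (b * a2)"
        by (simp add: algebra_simps)
      then show ?thesis
        unfolding I_def by auto
    qed
    have comb: "linear_form (s *s \<alpha> + t *s c) \<in> I" for s t
      unfolding I_def linear_form_combination
      by (rule CollectI, intro exI[of _ "Const s"] exI[of _ "Const t"]) (simp add: mult.commute)
    show "Var l - \<sigma> l \<in> I" for l
    proof -
      have eq: "Var l - \<sigma> l = linear_form (1 *s axis l 1 + (- (p $ l / p $ j)) *s axis j 1)"
        unfolding linear_form_combination linear_form_axis
        by (simp add: \<sigma>_def mult_ac divide_inverse)
      consider "l = i" | "l = j" | "l = k"
        using ijk by blast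
      then have "\<exists>s t. 1 *s axis l 1 + (- (p $ l / p $ j)) *s axis j 1 = s *s \<alpha> + t *s c"
      proof cases
        case 1
        have "1 *s axis l 1 + (- (p $ l / p $ j)) *s axis j 1 = (1 / p $ j) *s \<alpha> + 0 *s c"
          using j i by (simp add: vec_eq_iff 1 \<alpha>_def axis_def field_simps)
        then show ?thesis
          by blast
      next
        case 2
        have "1 *s axis l 1 + (- (p $ l / p $ j)) *s axis j 1 = 0 *s \<alpha> + 0 *s c"
          using j i by (simp add: vec_eq_iff 2 \<alpha>_def axis_def field_simps)
        then show ?thesis
          by blast
      next
        case 3
        \<comment> \<open>The entries \<open>k\<close> and \<open>i\<close> determine the two
          coefficients of the combination; the entry \<open>j\<close> then agrees because
          \<open>p\<close> lies on the line.\<close>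
        have pk: "p $ k = - (c $ i * p $ i + c $ j * p $ j) / c $ k"
          using cp k by (simp add: field_simps add_eq_0_iff)
        have "(1 *s axis l 1 + (- (p $ l / p $ j)) *s axis j 1) $ x
            = ((- (c $ i / (p $ j * c $ k))) *s \<alpha> + (1 / c $ k) *s c) $ x" for x
          using ijk[of x] j i k by (auto simp: 3 \<alpha>_def axis_def pk field_simps)
        then show ?thesis
          by (metis vec_eq_iff)
      qed
      then have "linear_form (1 *s axis l 1 + (- (p $ l / p $ j)) *s axis j 1) \<in> I"
        using comb by metis
      then show ?thesis
        by (simp only: eq)
    qed
  qed
  moreover have "subst \<sigma> q = 0"
    unfolding \<sigma>_def subst_scaled_homogeneous[OF q(1)] q(2) by simp
  ultimately show ?thesis
    using that unfolding I_def by auto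
qed

lemma span_subset_zero_locus:
  assumes "vec.span {p} \<subseteq> zero_locus c"
  shows "p \<in> zero_locus c"
  using assms vec.span_base[of p "{p}"] by auto

lemma span_eq_span_singleton:
  assumes "v \<noteq> 0" "v \<in> vec.span {p}"
  shows "vec.span {v} = vec.span {p :: complex ^ 3}"
proof -
  obtain a where a: "v = a *s p"
    using assms(2) unfolding vec.span_singleton by blast
  have "a \<noteq> 0"
    using a assms(1) by auto
  then have "range (\<lambda>k. k *s v) = range (\<lambda>k. k *s p)"
    unfolding a by (auto simp: image_iff) (metis nonzero_divide_eq_eq)
  then show ?thesis
    by (simp only: vec.span_singleton)
qed

text \<open>A form of degree \<open>n\<close> with more than \<open>n\<close> zeros on a projective
  line vanishes on it. In the induction one zero is split off as a linear factor modulo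
  \<open>c\<close>, and the cofactor still vanishes at the other points.\<close>

lemma linear_form_dvd_of_vanishing:
  assumes c: "c \<noteq> 0"
    and "homogeneous n q" "finite Q" "card Q > n"
    and "Q \<subseteq> proj_points" "\<And>P. P \<in> Q \<Longrightarrow> P \<subseteq> zero_locus c"
    and "\<And>P v. P \<in> Q \<Longrightarrow> v \<in> P \<Longrightarrow> v \<noteq> 0 \<Longrightarrow> eval_at v q = 0"
  shows "linear_form c dvd q"
  using assms(2-)
proof (induction n arbitrary: q Q)
  case 0
  obtain b where b: "q = Const b"
    using "0.prems"(1) by (rule homogeneous_0_Const)
  have "Q \<noteq> {}"
    using "0.prems"(3) by auto
  then obtain P where P: "P \<in> Q"
    by blast
  then obtain p where "P = vec.span {p}" "p \<noteq> 0"
    using "0.prems"(4) by (auto simp: proj_points_def)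
  then have "eval_at p q = 0"
    using "0.prems"(6)[OF P, of p] by (simp add: vec.span_base)
  then show ?case
    by (simp add: b)
next
  case (Suc n)
  have "Q \<noteq> {}"
    using Suc.prems(3) by auto
  then obtain P where P: "P \<in> Q"
    by blast
  then obtain p where p: "P = vec.span {p}" "p \<noteq> 0"
    using Suc.prems(4) by (auto simp: proj_points_def)
  have p_on: "p \<in> zero_locus c"
    using span_subset_zero_locus Suc.prems(5)[OF P] p by blast
  have "eval_at p q = 0"
    using Suc.prems(6)[OF P, of p] p by (simp add: vec.span_base)
  then obtain \<alpha> a b where
    \<alpha>: "\<And>v. v \<in> zero_locus c \<Longrightarrow> v \<in> zero_locus \<alpha> \<longleftrightarrow> v \<in> vec.span {p}"
    and q: "q = linear_form \<alpha> * a + linear_form c * b"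
    using vanishing_point_split[OF c p(2) p_on Suc.prems(1)] by blast
  \<comment> \<open>Passing to components makes the cofactor of \<open>\<alpha>\<close> homogeneous
    of degree \<open>n\<close>, as the induction hypothesis requires.\<close>
  have "q = hcomp (Suc n) q"
    using Suc.prems(1) by (simp add: hcomp_homogeneous)
  also have "\<dots> = linear_form \<alpha> * hcomp n a + linear_form c * hcomp n b"
    by (simp add: q hcomp_add hcomp_linear_form_mult)
  finally have q': "q = linear_form \<alpha> * hcomp n a + linear_form c * hcomp n b" .
  have "linear_form c dvd hcomp n a"
  proof (rule Suc.IH)
    show "card (Q - {P}) > n" "finite (Q - {P})"
      using Suc.prems(2,3) P by simp_all
    show "Q - {P} \<subseteq> proj_points" "\<And>P'. P' \<in> Q - {P} \<Longrightarrow> P' \<subseteq> zero_locus c"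
      using Suc.prems(4,5) by auto
    fix P' v assume P': "P' \<in> Q - {P}" and v: "v \<in> P'" "v \<noteq> 0"
    have v_on: "v \<in> zero_locus c"
      using Suc.prems(5) P' v by blast
    obtain p' where "P' = vec.span {p'}"
      using P' Suc.prems(4) by (auto simp: proj_points_def)
    then have "P' = vec.span {v}"
      using span_eq_span_singleton v by blast
    then have "v \<notin> vec.span {p}"
      using P' p span_eq_span_singleton v(2) by blast
    \<comment> \<open>On the line \<open>\<alpha>\<close> vanishes only at \<open>P\<close>, so at
      any other point the vanishing of \<open>q\<close> passes to the cofactor.\<close>
    then have "eval_at v (linear_form \<alpha>) \<noteq> 0"
      using \<alpha>[OF v_on] by simp
    moreover have "eval_at v (linear_form \<alpha>) * eval_at v (hcomp n a) = 0"
    proof -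
      have "eval_at v q = 0"
        using Suc.prems(6)[of P' v] P' v by blast
      moreover have "eval_at v (linear_form c) = 0"
        using v_on by simp
      ultimately show ?thesis
        by (subst (asm) q') (simp del: eval_at_linear_form_eq_0_iff)
    qed
    ultimately show "eval_at v (hcomp n a) = 0"
      by (metis mult_eq_0_iff)
  qed simp
  then show ?case
    by (subst q') simp
qed

section \<open>Intersection points of two lines\<close>

text \<open>The base ring is arbitrary because the product is taken both of complex vectors and of
  vectors of constant polynomials.\<close>

definition cross :: "'a :: comm_ring_1 ^ 3 \<Rightarrow> 'a ^ 3 \<Rightarrow> 'a ^ 3" where
  "cross a b = vector [a $ 2 * b $ 3 - a $ 3 * b $ 2,
    a $ 3 * b $ 1 - a $ 1 * b $ 3, a $ 1 * b $ 2 - a $ 2 * b $ 1]"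

lemma cross_kernel:
  fixes a b w :: "'a :: comm_ring_1 ^ 3"
  assumes "(\<Sum>i\<in>UNIV. a $ i * w $ i) = 0" "(\<Sum>i\<in>UNIV. b $ i * w $ i) = 0"
  shows "w $ i * cross a b $ j = w $ j * cross a b $ i"
proof -
  let ?aw = "\<Sum>i\<in>UNIV. a $ i * w $ i" and ?bw = "\<Sum>i\<in>UNIV. b $ i * w $ i"
  \<comment> \<open>Up to sign these are the entries of \<open>w \<times> (a \<times> b)\<close>,
    expanded by the identity for the double cross product.\<close>
  have "w $ 1 * cross a b $ 2 - w $ 2 * cross a b $ 1 = a $ 3 * ?bw - b $ 3 * ?aw"
    "w $ 1 * cross a b $ 3 - w $ 3 * cross a b $ 1 = b $ 2 * ?aw - a $ 2 * ?bw"
    "w $ 2 * cross a b $ 3 - w $ 3 * cross a b $ 2 = a $ 1 * ?bw - b $ 1 * ?aw"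
    by (simp_all add: cross_def vector_3 sum_3 algebra_simps)
  then have "w $ 1 * cross a b $ 2 = w $ 2 * cross a b $ 1"
    "w $ 1 * cross a b $ 3 = w $ 3 * cross a b $ 1"
    "w $ 2 * cross a b $ 3 = w $ 3 * cross a b $ 2"
    unfolding assms by simp_all
  then show ?thesis
    using exhaust_3[of i] exhaust_3[of j] by auto
qed

lemma cross_orthogonal:
  "(\<Sum>i\<in>UNIV. a $ i * cross a b $ i) = 0" "(\<Sum>i\<in>UNIV. b $ i * cross a b $ i) = 0"
  by (simp_all add: sum_3 cross_def vector_3 algebra_simps)

lemma cross_nonzero:
  assumes "c \<noteq> 0" "c' \<noteq> 0" "zero_locus c \<noteq> zero_locus c'"
  shows "cross c c' \<noteq> 0"
proof
  assume "cross c c' = 0"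
  then have "cross c c' $ i = 0" for i
    by simp
  from this[of 1] this[of 2] this[of 3]
  have "c $ i * c' $ j = c $ j * c' $ i" for i j
    using exhaust_3[of i] exhaust_3[of j] by (auto simp: cross_def vector_3)
  then show False
    using assms zero_locus_eqI by blast
qed

lemma span_singleton_subset_zero_locus_iff: "vec.span {p} \<subseteq> zero_locus c \<longleftrightarrow> p \<in> zero_locus c"
proof
  assume "p \<in> zero_locus c"
  then have "(\<Sum>i\<in>UNIV. c $ i * (k * p $ i)) = 0" for k
    by (simp add: zero_locus_def mult.left_commute[of _ k] flip: sum_distrib_left)
  then show "vec.span {p} \<subseteq> zero_locus c"
    unfolding vec.span_singleton by (auto simp: zero_locus_def)
qed (rule span_subset_zero_locus)

lemma proj_lines_meet:
  assumes "L \<in> proj_lines" "M \<in> proj_lines" "L \<noteq> M"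
  obtains P where "P \<in> proj_points" "P \<subseteq> L" "P \<subseteq> M"
proof
  let ?c = "line_coeffs L" and ?c' = "line_coeffs M"
  note L = line_coeffs[OF assms(1)] and M = line_coeffs[OF assms(2)]
  have "cross ?c ?c' \<noteq> 0"
    using L M assms(3) cross_nonzero by metis
  then show "vec.span {cross ?c ?c'} \<in> proj_points"
    by (auto simp: proj_points_def)
  have "cross ?c ?c' \<in> zero_locus ?c" "cross ?c ?c' \<in> zero_locus ?c'"
    by (simp_all only: zero_locus_def mem_Collect_eq cross_orthogonal)
  then show "vec.span {cross ?c ?c'} \<subseteq> L" "vec.span {cross ?c ?c'} \<subseteq> M"
    using L M span_singleton_subset_zero_locus_iff by metis+
qed

text \<open>The common kernel of two distinct lines is spanned by their cross product. The
  polynomial vector \<open>w\<close> and the point \<open>v\<close> are both proportional to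
  it.\<close>

lemma parallel_at_intersection:
  fixes w :: "S ^ 3"
  assumes "c \<noteq> 0" "c' \<noteq> 0" "zero_locus c \<noteq> zero_locus c'"
    and v: "v \<in> zero_locus c" "v \<in> zero_locus c'"
    and w: "(\<Sum>i\<in>UNIV. Const (c $ i) * w $ i) = 0" "(\<Sum>i\<in>UNIV. Const (c' $ i) * w $ i) = 0"
  shows "w $ i * Const (v $ j) = w $ j * Const (v $ i)"
proof -
  define n where "n = cross c c'"
  obtain l where l: "n $ l \<noteq> 0"
    using cross_nonzero[OF assms(1-3)] unfolding n_def by (rule vec3_nonzeroE)
  have "cross (\<chi> i. Const (c $ i)) (\<chi> i. Const (c' $ i)) $ i = Const (n $ i)" for i
    using exhaust_3[of i] by (auto simp: n_def cross_def vector_3)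
  then have W: "w $ i * Const (n $ j) = w $ j * Const (n $ i)" for i j
    using cross_kernel[of "\<chi> i. Const (c $ i)" w "\<chi> i. Const (c' $ i)" i j] w by simp
  have "v $ i * n $ j = v $ j * n $ i" for i j
    using cross_kernel[of c v c' i j] v by (simp add: n_def zero_locus_def)
  then have V: "Const (v $ i) * Const (n $ j) = Const (v $ j) * Const (n $ i)" for i j
    by (metis Const_simps(6))
  \<comment> \<open>Each of the two proportionalities brings in a factor \<open>n $ l\<close>; being
    a nonzero constant, its square cancels.\<close>
  have "(w $ i * Const (v $ j)) * Const (n $ l) ^ 2 = (w $ j * Const (v $ i)) * Const (n $ l) ^ 2"
    using W[of i l] W[of j l] V[of i l] V[of j l] by algebra
  then show ?thesis
    using l by simp
qed

section \<open>Syzygies of arrangements\<close>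

text \<open>The product rule turns \<theta>(f) = 0 into \<theta>(lf) g = - lf \<theta>(g), and the
  prime \<open>lf\<close> does not divide \<open>g\<close>. Geometrically, syzygies are tangent to
  every line of the arrangement.\<close>

lemma dvd_deriv_along_of_D0:
  assumes "finite A" "A \<subseteq> proj_lines" "L \<in> A" "\<theta> \<in> D0 (defining_poly A)"
  defines "lf \<equiv> linear_form (line_coeffs L)"
  shows "lf dvd deriv_along \<theta> lf"
proof -
  define g where "g = defining_poly (A - {L})"
  have "deriv_along \<theta> lf * g + lf * deriv_along \<theta> g = 0"
    using assms(4) defining_poly_remove[OF assms(1,3)]
    by (simp add: D0_iff deriv_along_mult lf_def g_def)
  then have "deriv_along \<theta> lf * g = lf * (- deriv_along \<theta> g)"
    by (simp add: eq_neg_iff_add_eq_0)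
  then have "lf dvd deriv_along \<theta> lf * g"
    by simp
  moreover have "\<not> lf dvd g"
    unfolding lf_def g_def using assms by (intro linear_form_not_dvd_defining_poly) auto
  moreover have "prime_elem lf"
    unfolding lf_def using assms line_coeffs by (intro prime_elem_linear_form) auto
  ultimately show ?thesis
    by (metis prime_elem_dvd_multD)
qed

section \<open>Minimal degree of a syzygy\<close>

definition has_syzygy :: "nat \<Rightarrow> (complex ^ 3) set set \<Rightarrow> bool" where
  "has_syzygy k A \<longleftrightarrow>
     (\<exists>\<theta>\<in>D0 (defining_poly A). \<theta> \<noteq> 0 \<and> (\<forall>i. homogeneous k (\<theta> $ i)))"

lemma has_syzygyI:
  assumes "deriv_along \<theta> (defining_poly A) = 0" "\<theta> \<noteq> 0" "\<And>i. homogeneous k (\<theta> $ i)"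
  shows "has_syzygy k A"
  unfolding has_syzygy_def using assms by (intro bexI[of _ \<theta>]) (auto simp: D0_iff)

lemma min_deg_le: "has_syzygy k A \<Longrightarrow> min_deg A \<le> k"
  unfolding min_deg_def has_syzygy_def by (rule Least_le)

text \<open>The Koszul syzygies guarantee that the minimum in \<open>min_deg\<close> is taken over a nonempty set.\<close>

lemma has_syzygy_min_deg:
  assumes "finite A" "A \<subseteq> proj_lines" "A \<noteq> {}"
  shows "has_syzygy (min_deg A) A"
proof -
  define f where "f = defining_poly A"
  have "deriv_along euler f = of_nat (card A) * f"
    unfolding f_def by (rule euler_defining_poly[OF assms(1)])
  also have "\<dots> \<noteq> 0"
    using assms defining_poly_nonzero[OF assms(1,2)] by (simp add: f_def)
  \<comment> \<open>If all partial derivatives vanished, so would the derivative along the Euler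
    field, contrary to Euler's identity.\<close>
  finally have "\<exists>i. partial_deriv i f \<noteq> 0"
    by (rule contrapos_np) (simp add: deriv_along_def)
  then obtain i where i: "partial_deriv i f \<noteq> 0"
    by blast
  obtain j where j: "j \<noteq> i"
    by (rule that[of "i + 1"]) simp
  obtain k where k: "k \<noteq> j" "k \<noteq> i" "UNIV = {k, j, i}"
    using third_index[OF j] by blast
  define \<theta> :: "S ^ 3" where "\<theta> = (\<chi> l. if l = i then partial_deriv j f
    else if l = j then - partial_deriv i f else 0)"
  have "deriv_along \<theta> f = 0"
    unfolding deriv_along_def sum_UNIV_distinct[OF k(1,2) j k(3)]
    using k j by (simp add: \<theta>_def mult.commute)
  moreover have "\<theta> \<noteq> 0"
  proof
    assume "\<theta> = 0"
    then have "\<theta> $ j = 0"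
      by simp
    then show False
      using i j by (simp add: \<theta>_def)
  qed
  moreover have "homogeneous (card A) f"
    unfolding f_def by (rule homogeneous_defining_poly[OF assms(1)])
  then have pd: "homogeneous (card A - 1) (partial_deriv l f)" for l
    by (rule homogeneous_partial_deriv)
  have "homogeneous (card A - 1) (\<theta> $ l)" for l
    using pd homogeneous_uminus[OF pd] by (simp add: \<theta>_def)
  ultimately have "has_syzygy (card A - 1) A"
    unfolding f_def by (rule has_syzygyI)
  then show ?thesis
    unfolding min_deg_def has_syzygy_def by (rule LeastI)
qed

section \<open>Syzygies under insertion and removal of a line\<close>

lemma homogeneous_deriv_along_linear_form:
  assumes "\<And>i. homogeneous k (\<theta> $ i)"
  shows "homogeneous k (deriv_along \<theta> (linear_form c))"
  unfolding deriv_along_linear_form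
  by (intro homogeneous_sum homogeneous_Const_mult assms)

lemma homogeneous_of_nat_mult: "homogeneous k p \<Longrightarrow> homogeneous k (of_nat n * p)"
  using homogeneous_Const_mult[of k p "of_nat n"] by simp

lemma deriv_along_0 [simp]: "deriv_along 0 p = 0"
  by (simp add: deriv_along_def)

lemma has_syzygy_insert_line:
  assumes A: "finite A" "A \<subseteq> proj_lines" "L \<in> A" "A - {L} \<noteq> {}"
    and "has_syzygy k (A - {L})"
  shows "has_syzygy (Suc k) A"
proof -
  define lf where "lf = linear_form (line_coeffs L)"
  define g where "g = defining_poly (A - {L})"
  define f where "f = defining_poly A"
  have f: "f = lf * g"
    unfolding f_def g_def lf_def by (rule defining_poly_remove[OF A(1,3)])
  have lf0: "lf \<noteq> 0"
    unfolding lf_def using A line_coeffs by (intro linear_form_nonzero) auto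
  have g0: "g \<noteq> 0"
    unfolding g_def using A by (intro defining_poly_nonzero) auto
  have Ef: "deriv_along euler f = of_nat (card A) * f"
    unfolding f_def by (rule euler_defining_poly[OF A(1)])
  have Eg: "deriv_along euler g = of_nat (card (A - {L})) * g"
    unfolding g_def by (rule euler_defining_poly) (use A in simp)
  have n: "card (A - {L}) \<noteq> 0" "card A \<noteq> 0"
    using A(1,3) A(4) by (metis card_eq_0_iff finite_Diff, auto)
  obtain \<delta> where \<delta>: "\<delta> \<in> D0 g" "\<delta> \<noteq> 0" "\<And>i. homogeneous k (\<delta> $ i)"
    using assms(5) unfolding has_syzygy_def g_def by blast
  note \<delta> = \<delta>[unfolded D0_iff]
  define h where "h = deriv_along \<delta> lf"
  \<comment> \<open>The field \<open>lf\<close> times \<open>\<delta>\<close> multiplies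
    \<open>f\<close> by \<open>h\<close>, and the Euler field multiplies it by
    \<open>card A\<close>, so this combination annihilates \<open>f\<close>.\<close>
  define \<theta> where "\<theta> = (\<chi> i. (of_nat (card A) * lf) * \<delta> $ i + (- h) * euler $ i)"
  note deriv_\<theta> = deriv_along_combination[of "of_nat (card A) * lf" \<delta> "- h" euler, folded \<theta>_def]
  have "deriv_along \<theta> f = 0"
  proof -
    have "deriv_along \<delta> f = h * g"
      by (simp add: f deriv_along_mult \<delta> h_def)
    then show ?thesis
      unfolding deriv_\<theta> Ef by (simp add: f algebra_simps)
  qed
  \<comment> \<open>On \<open>g\<close> only the Euler term of \<open>\<theta>\<close> survives,
    since \<open>\<delta>\<close> kills \<open>g\<close>. Its eigenvalue is nonzero because lines
    remain, so \<open>\<theta> = 0\<close> would force \<open>h = 0\<close> and then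
    \<open>\<delta> = 0\<close>.\<close>
  moreover have "\<theta> \<noteq> 0"
  proof
    assume "\<theta> = 0"
    then have "h * (of_nat (card (A - {L})) * g) = 0"
      using deriv_\<theta>[of g] by (simp add: \<delta>(1) Eg)
    then have h0: "h = 0"
      using n g0 by simp
    have "\<theta> $ i = 0" for i
      using \<open>\<theta> = 0\<close> by simp
    then have "\<delta> $ i = 0" for i
      using n lf0 by (simp add: \<theta>_def h0)
    then show False
      using \<delta>(2) by (simp add: vec_eq_iff)
  qed
  moreover have "homogeneous (Suc k) (\<theta> $ i)" for i
  proof -
    have 1: "homogeneous (1 + k) (lf * \<delta> $ i)"
      unfolding lf_def by (intro homogeneous_mult homogeneous_linear_form \<delta>(3))
    have "homogeneous k h"
      unfolding h_def lf_def by (rule homogeneous_deriv_along_linear_form[OF \<delta>(3)])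
    then have 2: "homogeneous (k + 1) (h * Var i)"
      by (intro homogeneous_mult homogeneous_Var)
    show ?thesis
      using homogeneous_diff[OF homogeneous_of_nat_mult[OF 1, of "card A"], of "h * Var i"] 2
      by (simp add: \<theta>_def mult.assoc)
  qed
  ultimately show ?thesis
    unfolding f_def by (rule has_syzygyI)
qed

text \<open>Positive degree leaves room for a cofactor of degree \<open>k\<close>. Tangency to
  \<open>L\<close> is recorded because a syzygy of \<open>A - {L}\<close> need not be tangent to
  \<open>L\<close> in general.\<close>

lemma syzygy_remove_line:
  assumes A: "finite A" "A \<subseteq> proj_lines" "L \<in> A" "A - {L} \<noteq> {}"
    and syz: "has_syzygy (Suc k) A"
  defines "lf \<equiv> linear_form (line_coeffs L)"
  obtains \<delta> where "\<delta> \<in> D0 (defining_poly (A - {L}))" "\<delta> \<noteq> 0"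
    "\<forall>i. homogeneous (Suc k) (\<delta> $ i)" "lf dvd deriv_along \<delta> lf"
proof -
  define g where "g = defining_poly (A - {L})"
  define f where "f = defining_poly A"
  have f: "f = lf * g"
    unfolding f_def g_def lf_def by (rule defining_poly_remove[OF A(1,3)])
  have lf0: "lf \<noteq> 0"
    unfolding lf_def using A line_coeffs by (intro linear_form_nonzero) auto
  have f0: "f \<noteq> 0"
    unfolding f_def using A by (intro defining_poly_nonzero) auto
  have Ef: "deriv_along euler f = of_nat (card A) * f"
    unfolding f_def by (rule euler_defining_poly[OF A(1)])
  define n where "n = card (A - {L})"
  have Eg: "deriv_along euler g = of_nat n * g"
    unfolding g_def n_def by (rule euler_defining_poly) (use A in simp)
  have n: "n \<noteq> 0" "card A \<noteq> 0"
    unfolding n_def using A(1,3) A(4) by (metis card_eq_0_iff finite_Diff, auto)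
  obtain \<theta> where \<theta>: "\<theta> \<in> D0 f" "\<theta> \<noteq> 0" "\<And>i. homogeneous (Suc k) (\<theta> $ i)"
    using syz unfolding has_syzygy_def f_def by blast
  have "lf dvd deriv_along \<theta> lf"
    unfolding lf_def using A(1-3) \<theta>(1)[unfolded f_def] by (rule dvd_deriv_along_of_D0)
  then obtain h' where h': "deriv_along \<theta> lf = lf * h'"
    by blast
  have "homogeneous (Suc k) (deriv_along \<theta> lf)"
    unfolding lf_def by (rule homogeneous_deriv_along_linear_form[OF \<theta>(3)])
  then have "deriv_along \<theta> lf = hcomp (Suc k) (lf * h')"
    by (simp add: hcomp_homogeneous h')
  \<comment> \<open>Replacing the quotient by its component of degree \<open>k\<close> leaves the
    product unchanged and yields a homogeneous cofactor.\<close>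
  moreover define h where "h = hcomp k h'"
  ultimately have h: "deriv_along \<theta> lf = lf * h"
    by (simp add: lf_def hcomp_linear_form_mult)
  have \<theta>g: "deriv_along \<theta> g = - h * g"
  proof -
    have "lf * (h * g + deriv_along \<theta> g) = 0"
      using \<theta>(1) by (simp add: D0_iff f deriv_along_mult h algebra_simps)
    then show ?thesis
      using lf0 by (simp add: add_eq_0_iff)
  qed
  \<comment> \<open>On \<open>g\<close> the field \<open>\<theta>\<close> acts as multiplication by
    \<open>- h\<close> and the Euler field as multiplication by \<open>n\<close>, so the two terms
    cancel. On \<open>f\<close> the combination acts as multiplication by
    \<open>h * of_nat (card A)\<close>, which is used to see that it is nonzero.\<close>
  define \<delta> where "\<delta> = (\<chi> i. of_nat n * \<theta> $ i + h * euler $ i)"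
  note deriv_\<delta> = deriv_along_combination[of "of_nat n" \<theta> h euler, folded \<delta>_def]
  show ?thesis
  proof
    show "\<delta> \<in> D0 (defining_poly (A - {L}))"
      unfolding D0_iff g_def[symmetric] deriv_\<delta> \<theta>g Eg by (simp add: algebra_simps)
    show "\<delta> \<noteq> 0"
    proof
      assume "\<delta> = 0"
      then have "h * (of_nat (card A) * f) = 0"
        using deriv_\<delta>[of f] \<theta>(1) by (simp add: D0_iff Ef)
      then have h0: "h = 0"
        using n f0 by simp
      have "\<delta> $ i = 0" for i
        using \<open>\<delta> = 0\<close> by simp
      then have "\<theta> $ i = 0" for i
        using n by (simp add: \<delta>_def h0)
      then show False
        using \<theta>(2) by (simp add: vec_eq_iff)
    qed
    show "\<forall>i. homogeneous (Suc k) (\<delta> $ i)"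
    proof
      fix i
      have "homogeneous (k + 1) (h * Var i)"
        unfolding h_def by (intro homogeneous_mult homogeneous_Var homogeneous_hcomp)
      then show "homogeneous (Suc k) (\<delta> $ i)"
        using homogeneous_add[OF homogeneous_of_nat_mult[OF \<theta>(3)]] by (simp add: \<delta>_def)
    qed
    have "deriv_along \<delta> lf = lf * (of_nat n * h + h)"
      unfolding deriv_\<delta> h by (simp add: lf_def euler_linear_form algebra_simps)
    then show "lf dvd deriv_along \<delta> lf"
      by simp
  qed
qed

text \<open>Fields of degree zero are constant vectors. Such a field kills the forms vanishing at
  its direction; conversely, the derivative of a form along it is a constant divisible by that form,
  hence zero.\<close>

lemma concurrent_iff_has_syzygy_0:
  assumes "finite A" "A \<subseteq> proj_lines"
  shows "concurrent A \<longleftrightarrow> has_syzygy 0 A"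
proof
  assume "concurrent A"
  then obtain w where w: "w \<noteq> 0" "\<And>L. L \<in> A \<Longrightarrow> vec.span {w} \<subseteq> L"
    by (auto simp: concurrent_def proj_points_def)
  define \<theta> :: "S ^ 3" where "\<theta> = (\<chi> i. Const (w $ i))"
  have kill: "deriv_along \<theta> (linear_form (line_coeffs L)) = 0" if L: "L \<in> A" for L
  proof -
    have "vec.span {w} \<subseteq> zero_locus (line_coeffs L)"
      using w(2) L assms line_coeffs by blast
    then have "Const (\<Sum>i\<in>UNIV. line_coeffs L $ i * w $ i) = 0"
      using span_subset_zero_locus by (simp add: zero_locus_def)
    then show ?thesis
      by (simp add: deriv_along_linear_form \<theta>_def Const_sum)
  qed
  have "deriv_along \<theta> (defining_poly A) = 0"
    using assms(1) kill unfolding defining_poly_def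
    by (induction A) (simp_all add: deriv_along_mult)
  moreover have "\<theta> \<noteq> 0"
    using w(1) by (auto simp: vec_eq_iff \<theta>_def)
  moreover have "homogeneous 0 (\<theta> $ i)" for i
    by (simp add: \<theta>_def)
  ultimately show "has_syzygy 0 A"
    by (rule has_syzygyI)
next
  assume "has_syzygy 0 A"
  then obtain \<theta> where \<theta>: "\<theta> \<in> D0 (defining_poly A)" "\<theta> \<noteq> 0" "\<And>i. homogeneous 0 (\<theta> $ i)"
    unfolding has_syzygy_def by blast
  have "\<exists>a. \<theta> $ i = Const a" for i
    using homogeneous_0_Const[OF \<theta>(3)[of i]] by blast
  then obtain a where a: "\<And>i. \<theta> $ i = Const (a i)"
    by metis
  define w :: "complex ^ 3" where "w = (\<chi> i. a i)"
  have "w \<noteq> 0"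
    using \<theta>(2) a by (auto simp: w_def vec_eq_iff)
  moreover have "vec.span {w} \<subseteq> L" if L: "L \<in> A" for L
  proof -
    have c: "line_coeffs L \<noteq> 0" "L = zero_locus (line_coeffs L)"
      using line_coeffs L assms by blast+
    have "linear_form (line_coeffs L) dvd deriv_along \<theta> (linear_form (line_coeffs L))"
      using dvd_deriv_along_of_D0[OF assms L \<theta>(1)] .
    also have "\<dots> = Const (\<Sum>i\<in>UNIV. line_coeffs L $ i * w $ i)"
      by (simp add: deriv_along_linear_form a w_def Const_sum)
    finally have "w \<in> zero_locus (line_coeffs L)"
      unfolding linear_form_dvd_Const_iff[OF c(1)] zero_locus_def by simp
    then show ?thesis
      using c span_singleton_subset_zero_locus_iff by metis
  qed
  ultimately show "concurrent A"
    unfolding concurrent_def proj_points_def by blast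
qed

text \<open>Modulo \<open>c\<close> the polynomial ring is factorial, so a vector field parallel to the Euler field
  along the line is a multiple of it there.\<close>

lemma parallel_euler_mod_linear_form:
  fixes \<delta> :: "S ^ 3"
  assumes c: "c \<noteq> 0"
    and parallel: "\<And>i j. linear_form c dvd \<delta> $ i * Var j - \<delta> $ j * Var i"
    and tangent: "linear_form c dvd deriv_along \<delta> (linear_form c)"
  obtains h where "\<And>l. linear_form c dvd \<delta> $ l - h * Var l"
proof -
  obtain k where k: "c $ k \<noteq> 0"
    using c by (rule vec3_nonzeroE)
  obtain j where j: "j \<noteq> k"
    by (rule that[of "k + 1"]) simp
  obtain i where i: "i \<noteq> j" "i \<noteq> k" and UN: "UNIV = {i, j, k}"
    using third_index[OF j] by blast
  let ?\<sigma> = "subst (elim c k)"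
  have Var_\<sigma>: "?\<sigma> (Var i) = Var i" "?\<sigma> (Var j) = Var j"
    using i j by (simp_all add: elim_def)
  have eq: "?\<sigma> (\<delta> $ i) * Var j = ?\<sigma> (\<delta> $ j) * Var i"
    using parallel[of i j] Var_\<sigma> by (simp add: linear_form_dvd_iff[OF k])
  \<comment> \<open>The factor \<open>h\<close> arises as follows: \<open>Var i\<close> is prime and
    does not divide \<open>Var j\<close>, so by \<open>eq\<close> it divides the reduced component
    \<open>i\<close>. Cancelling it gives the component \<open>j\<close> with the same
    factor.\<close>
  have "\<not> Var i dvd Var j"
  proof
    assume "Var i dvd Var j"
    then obtain b where "Var j = Var i * b"
      by blast
    then have "eval_at (axis j 1) (Var j) = eval_at (axis j 1) (Var i) * eval_at (axis j 1) b"
      by (metis subst_mult)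
    then show False
      using i by (simp add: axis_def)
  qed
  moreover have "Var i dvd ?\<sigma> (\<delta> $ i) * Var j"
    unfolding eq by simp
  ultimately have "Var i dvd ?\<sigma> (\<delta> $ i)"
    using prime_elem_dvd_multD[OF prime_elem_Var] by blast
  then obtain h where hi: "?\<sigma> (\<delta> $ i) = h * Var i"
    by (metis dvdE mult.commute)
  have "Var i \<noteq> 0"
    using prime_elem_Var[of i] by auto
  moreover have "(h * Var j) * Var i = ?\<sigma> (\<delta> $ j) * Var i"
    using eq hi by (simp add: mult_ac)
  ultimately have hj: "?\<sigma> (\<delta> $ j) = h * Var j"
    by (metis mult_right_cancel)
  have di: "linear_form c dvd \<delta> $ i - h * Var i" and dj: "linear_form c dvd \<delta> $ j - h * Var j"
    using elim_cong[of c "\<delta> $ i" k] elim_cong[of c "\<delta> $ j" k] hi hj by simp_all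
  \<comment> \<open>Tangency yields the remaining component: the difference is a combination of the
    three \<open>\<delta> $ l - h * Var l\<close> with coefficients \<open>c $ l\<close>, two of
    them are already divisible, and \<open>c $ k\<close> is invertible.\<close>
  have "linear_form c dvd deriv_along \<delta> (linear_form c) - h * linear_form c"
    using tangent by simp
  also have "\<dots> = (\<Sum>l\<in>UNIV. Const (c $ l) * (\<delta> $ l - h * Var l))"
    unfolding deriv_along_linear_form
    by (simp add: linear_form_eq right_diff_distrib sum_subtractf sum_distrib_left mult_ac)
  also have "\<dots> = Const (c $ i) * (\<delta> $ i - h * Var i) + (Const (c $ j) * (\<delta> $ j - h * Var j)
      + Const (c $ k) * (\<delta> $ k - h * Var k))"
    by (rule sum_UNIV_distinct[OF i j UN])
  finally have "linear_form c dvd Const (c $ k) * (\<delta> $ k - h * Var k)"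
    using di dj by (metis dvd_add_right_iff dvd_mult)
  then have "linear_form c dvd Const (1 / c $ k) * (Const (c $ k) * (\<delta> $ k - h * Var k))"
    by (rule dvd_mult)
  moreover have "Const (1 / c $ k) * Const (c $ k) = 1"
    using k by (simp flip: Const_simps(6))
  ultimately have "linear_form c dvd \<delta> $ k - h * Var k"
    by (simp flip: mult.assoc)
  then have "\<forall>l\<in>{i, j, k}. linear_form c dvd \<delta> $ l - h * Var l"
    using di dj by blast
  then have "linear_form c dvd \<delta> $ l - h * Var l" for l
    unfolding UN[symmetric] by blast
  then show ?thesis
    by (rule that)
qed

lemma syzygy_divisible_by_line:
  assumes B: "finite B" "B \<subseteq> proj_lines" "B \<noteq> {}"
    and L: "L \<in> proj_lines" "L \<notin> B"
  defines "lf \<equiv> linear_form (line_coeffs L)"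
  assumes \<delta>: "\<delta> \<in> D0 (defining_poly B)" "\<delta> \<noteq> 0" "\<And>i. homogeneous (Suc k) (\<delta> $ i)"
    and tangent: "lf dvd deriv_along \<delta> lf"
    and Q: "finite Q" "card Q > Suc (Suc k)" "Q \<subseteq> proj_points"
      "\<And>P. P \<in> Q \<Longrightarrow> P \<subseteq> L" "\<And>P. P \<in> Q \<Longrightarrow> \<exists>M\<in>B. P \<subseteq> M"
  shows "has_syzygy k B"
proof -
  define c where "c = line_coeffs L"
  have c: "c \<noteq> 0" "L = zero_locus c"
    using line_coeffs[OF L(1)] by (simp_all add: c_def)
  have lf: "lf = linear_form c"
    by (simp add: lf_def c_def)
  \<comment> \<open>The minors have degree \<open>Suc (Suc k)\<close>, hence the bound on
    \<open>card Q\<close>. At a point of \<open>Q\<close>, tangency to \<open>L\<close> and to a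
    second line \<open>M\<close> forces the field into the direction of the point.\<close>
  have parallel: "linear_form c dvd \<delta> $ i * Var j - \<delta> $ j * Var i" for i j
  proof (rule linear_form_dvd_of_vanishing[OF c(1) _ Q(1-3)])
    have "homogeneous (Suc k + 1) (\<delta> $ i * Var j - \<delta> $ j * Var i)"
      by (intro homogeneous_diff homogeneous_mult \<delta>(3) homogeneous_Var)
    then show "homogeneous (Suc (Suc k)) (\<delta> $ i * Var j - \<delta> $ j * Var i)"
      by simp
    show "P \<subseteq> zero_locus c" if "P \<in> Q" for P
      using Q(4)[OF that] c by simp
    fix P v assume P: "P \<in> Q" and v: "v \<in> P"
    obtain M where M: "M \<in> B" "P \<subseteq> M"
      using Q(5)[OF P] by blast
    define b where "b = line_coeffs M"
    have b: "b \<noteq> 0" "M = zero_locus b"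
      using line_coeffs[of M] M B by (auto simp: b_def)
    have v_on: "v \<in> zero_locus c" "v \<in> zero_locus b"
      using Q(4)[OF P] M v b c by auto
    define w :: "S ^ 3" where "w = (\<chi> l. eval_at v (\<delta> $ l))"
    have kill: "(\<Sum>l\<in>UNIV. Const (a $ l) * w $ l) = 0"
      if "v \<in> zero_locus a" "linear_form a dvd deriv_along \<delta> (linear_form a)" for a
    proof -
      have "eval_at v (linear_form a) = 0"
        using that(1) by simp
      then have "eval_at v (deriv_along \<delta> (linear_form a)) = 0"
        using that(2) by (auto simp del: eval_at_linear_form_eq_0_iff)
      then show ?thesis
        by (simp add: deriv_along_linear_form w_def)
    qed
    have "linear_form b dvd deriv_along \<delta> (linear_form b)"
      unfolding b_def using B(1,2) M(1) \<delta>(1) by (rule dvd_deriv_along_of_D0)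
    moreover have "zero_locus c \<noteq> zero_locus b"
      using b c M L by auto
    ultimately have "w $ i * Const (v $ j) = w $ j * Const (v $ i)"
      using parallel_at_intersection[OF c(1) b(1) _ v_on] kill v_on tangent lf by simp
    then show "eval_at v (\<delta> $ i * Var j - \<delta> $ j * Var i) = 0"
      by (simp add: w_def)
  qed
  obtain h where h: "\<And>l. linear_form c dvd \<delta> $ l - h * Var l"
    using parallel_euler_mod_linear_form[OF c(1) parallel] tangent lf by blast
  then have "\<exists>\<eta>. \<forall>l. \<delta> $ l - h * Var l = lf * \<eta> l"
    unfolding lf dvd_def by metis
  then obtain \<eta> where \<eta>: "\<And>l. \<delta> $ l - h * Var l = lf * \<eta> l"
    by blast
  define g where "g = defining_poly B"
  have Eg: "deriv_along euler g = of_nat (card B) * g"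
    unfolding g_def by (rule euler_defining_poly[OF B(1)])
  define H :: "S ^ 3" where "H = (\<chi> l. \<eta> l)"
  have "\<delta> = (\<chi> l. lf * H $ l + h * euler $ l)"
    using \<eta> by (simp add: vec_eq_iff H_def algebra_simps)
  \<comment> \<open>The left side is zero and the first summand is divisible by \<open>lf\<close>,
    so \<open>lf\<close> divides \<open>h\<close> times a nonzero constant times \<open>g\<close>;
    as a prime not dividing \<open>g\<close> it divides \<open>h\<close>.\<close>
  then have "deriv_along \<delta> g = lf * deriv_along H g + h * (of_nat (card B) * g)"
    by (simp only: deriv_along_combination Eg)
  then have "h * (of_nat (card B) * g) = lf * (- deriv_along H g)"
    using \<delta>(1) by (simp add: D0_iff g_def eq_neg_iff_add_eq_0 add.commute)
  then have "lf dvd h * (Const (of_nat (card B)) * g)"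
    by simp
  moreover have prime: "prime_elem lf"
    unfolding lf by (rule prime_elem_linear_form[OF c(1)])
  moreover have "\<not> lf dvd g"
    unfolding lf_def g_def by (rule linear_form_not_dvd_defining_poly[OF B(1,2) L])
  moreover have "\<not> lf dvd Const (of_nat (card B))"
    unfolding lf linear_form_dvd_Const_iff[OF c(1)] using B by simp
  ultimately have "lf dvd h"
    by (metis prime_elem_dvd_multD)
  then obtain h1 where h1: "h = lf * h1"
    by blast
  \<comment> \<open>The quotient of \<open>\<delta>\<close> by \<open>lf\<close>; taking components
    of degree \<open>k\<close> makes it homogeneous.\<close>
  define \<delta>1 :: "S ^ 3" where "\<delta>1 = (\<chi> l. hcomp k (\<eta> l + h1 * Var l))"
  have \<delta>1: "\<delta> $ l = lf * \<delta>1 $ l" for l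
  proof -
    have "\<delta> $ l = lf * (\<eta> l + h1 * Var l)"
      using \<eta>[of l] by (simp add: h1 algebra_simps)
    then have "hcomp (Suc k) (\<delta> $ l) = lf * hcomp k (\<eta> l + h1 * Var l)"
      by (simp only: lf hcomp_linear_form_mult)
    then show ?thesis
      by (simp add: \<delta>1_def hcomp_homogeneous[OF \<delta>(3)])
  qed
  have "lf * deriv_along \<delta>1 g = deriv_along \<delta> g"
    by (simp add: deriv_along_def \<delta>1 sum_distrib_left mult.assoc)
  then have "deriv_along \<delta>1 g = 0"
    using \<delta>(1) prime by (auto simp: D0_iff g_def)
  moreover have "\<delta>1 \<noteq> 0"
    using \<delta>(2) \<delta>1 by (auto simp: vec_eq_iff)
  moreover have "homogeneous k (\<delta>1 $ l)" for l
    by (simp add: \<delta>1_def)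
  ultimately show ?thesis
    unfolding g_def by (rule has_syzygyI)
qed

section \<open>Removing a line\<close>

lemma singular_pointsI:
  assumes "finite A" "P \<in> proj_points" "L \<in> A" "M \<in> A" "L \<noteq> M" "P \<subseteq> L" "P \<subseteq> M"
  shows "P \<in> singular_points A"
proof -
  have "card {L, M} \<le> card {N \<in> A. P \<subseteq> N}"
    using assms by (intro card_mono) auto
  then show ?thesis
    using assms by (simp add: singular_points_def multiplicity_at_def)
qed

lemma singular_point_other_line:
  assumes "P \<in> singular_points A"
  shows "\<exists>M\<in>A - {L}. P \<subseteq> M"
proof (rule ccontr)
  assume "\<not> ?thesis"
  then have "{M \<in> A. P \<subseteq> M} \<subseteq> {L}"
    by blast
  then have "card {M \<in> A. P \<subseteq> M} \<le> card {L}"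
    by (intro card_mono) auto
  then show False
    using assms by (simp add: singular_points_def multiplicity_at_def)
qed

text \<open>Two lines of \<open>B\<close> meet, so the maximum for \<open>B\<close> is attained at a
  singular point, which is singular for \<open>A\<close> with at least the same
  multiplicity.\<close>

lemma max_multiplicity_mono:
  assumes "finite A" "B \<subseteq> A" "B \<subseteq> proj_lines" "card B \<ge> 2"
  shows "max_multiplicity B \<le> max_multiplicity A"
proof -
  have le: "multiplicity_at C P \<le> multiplicity_at A P" if "C \<subseteq> A" for C P
    unfolding multiplicity_at_def using assms(1) that by (intro card_mono) auto
  have fin: "finite (multiplicity_at C ` X)" if "C \<subseteq> A" for C X
  proof (rule finite_subset)
    show "multiplicity_at C ` X \<subseteq> {..card A}"
      unfolding multiplicity_at_def using assms(1) that by (auto intro!: card_mono)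
  qed simp
  have finB: "finite B"
    using assms finite_subset by blast
  obtain L M where LM: "L \<in> B" "M \<in> B" "L \<noteq> M"
    using assms(4) by (metis card_le_Suc0_iff_eq finB not_less_eq_eq numeral_2_eq_2)
  then obtain P where "P \<in> proj_points" "P \<subseteq> L" "P \<subseteq> M"
    using assms(3) by (metis proj_lines_meet subsetD)
  then have "P \<in> singular_points B"
    using LM finB by (intro singular_pointsI)
  then have "max_multiplicity B \<in> multiplicity_at B ` singular_points B"
    unfolding max_multiplicity_def using fin[OF assms(2)] by (intro Max_in) auto
  then obtain R where R: "R \<in> singular_points B" "max_multiplicity B = multiplicity_at B R"
    by blast
  have "multiplicity_at B R \<le> multiplicity_at A R"
    by (rule le[OF assms(2)])
  moreover have "R \<in> singular_points A"
    using R(1) le[OF assms(2), of R] by (simp add: singular_points_def)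
  then have "multiplicity_at A R \<le> max_multiplicity A"
    unfolding max_multiplicity_def by (intro Max_ge fin) auto
  ultimately show ?thesis
    using R(2) by simp
qed

section \<open>Effect of removing a line on the minimal degree\<close>

lemma min_deg_remove_line_le:
  assumes "finite A" "A \<subseteq> proj_lines" "L \<in> A" "A - {L} \<noteq> {}" "\<not> concurrent A"
  shows "min_deg (A - {L}) \<le> min_deg A"
proof -
  have syz: "has_syzygy (min_deg A) A"
    using assms by (intro has_syzygy_min_deg) auto
  \<comment> \<open>An essential arrangement has no constant syzygy, so the minimal degree is
    positive.\<close>
  then obtain k where k: "min_deg A = Suc k"
    using assms concurrent_iff_has_syzygy_0 by (metis not0_implies_Suc)
  obtain \<delta> where "\<delta> \<in> D0 (defining_poly (A - {L}))" "\<delta> \<noteq> 0"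
    "\<forall>i. homogeneous (Suc k) (\<delta> $ i)"
    by (rule syzygy_remove_line[OF assms(1-4) syz[unfolded k]])
  then have "has_syzygy (Suc k) (A - {L})"
    unfolding has_syzygy_def by blast
  then show ?thesis
    unfolding k by (rule min_deg_le)
qed

lemma min_deg_le_Suc_remove_line:
  assumes "finite A" "A \<subseteq> proj_lines" "L \<in> A" "A - {L} \<noteq> {}"
  shows "min_deg A \<le> Suc (min_deg (A - {L}))"
proof -
  have "has_syzygy (min_deg (A - {L})) (A - {L})"
    using assms by (intro has_syzygy_min_deg) auto
  then show ?thesis
    by (intro min_deg_le has_syzygy_insert_line[OF assms])
qed

text \<open>Otherwise the minimal syzygy, transferred to \<open>A - {L}\<close>, is divisible by the
  form of \<open>L\<close>, and the quotient contradicts the equality of minimal degrees.\<close>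

lemma num_singular_on_le:
  assumes A: "finite A" "A \<subseteq> proj_lines" "L \<in> A" "A - {L} \<noteq> {}" "\<not> concurrent A"
    and eq: "min_deg (A - {L}) = min_deg A"
  shows "num_singular_on A L \<le> min_deg A + 1"
proof (rule ccontr)
  define Q where "Q = {P \<in> singular_points A. P \<subseteq> L}"
  assume "\<not> ?thesis"
  then have card: "card Q > min_deg A + 1"
    by (simp add: num_singular_on_def Q_def)
  have syz: "has_syzygy (min_deg A) A"
    using A by (intro has_syzygy_min_deg) auto
  then obtain k where k: "min_deg A = Suc k"
    using A concurrent_iff_has_syzygy_0 by (metis not0_implies_Suc)
  obtain \<delta> where \<delta>: "\<delta> \<in> D0 (defining_poly (A - {L}))" "\<delta> \<noteq> 0"
    "\<forall>i. homogeneous (Suc k) (\<delta> $ i)"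
    "linear_form (line_coeffs L) dvd deriv_along \<delta> (linear_form (line_coeffs L))"
    by (rule syzygy_remove_line[OF A(1-4) syz[unfolded k]])
  have "has_syzygy k (A - {L})"
  proof (rule syzygy_divisible_by_line[OF _ _ A(4) _ _ \<delta>(1,2) _ \<delta>(4)])
    \<comment> \<open>\<open>card\<close> is 0 on infinite sets, so the lower bound on
      \<open>card Q\<close> gives finiteness.\<close>
    show "finite Q"
      using card card.infinite by force
    show "card Q > Suc (Suc k)"
      using card k by simp
    show "Q \<subseteq> proj_points"
      by (auto simp: Q_def singular_points_def)
    show "P \<subseteq> L" if "P \<in> Q" for P
      using that by (simp add: Q_def)
    show "\<exists>M\<in>A - {L}. P \<subseteq> M" if "P \<in> Q" for P
      using that by (intro singular_point_other_line) (simp add: Q_def)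
  qed (use A \<delta>(3) in auto)
  then have "min_deg (A - {L}) \<le> k"
    by (rule min_deg_le)
  then show False
    using eq k by simp
qed

lemma counterexample_remove_line:
  assumes ce: "counterexample d A A'" and iso: "lattice_iso \<phi> A A'" and L: "L \<in> A"
  defines "B \<equiv> A - {L}" and "B' \<equiv> A' - {\<phi> L}" and "r \<equiv> min_deg A"
  shows "min_deg B \<in> {r - 1, r}" "min_deg B' \<ge> r"
    "min_deg B = r \<Longrightarrow> num_singular_on A L \<le> r + 1"
    "min_deg B = r - 1 \<Longrightarrow> counterexample (d - 1) B B'"
    "max_multiplicity B \<le> max_multiplicity A"
proof -
  have A: "finite A" "A \<subseteq> proj_lines" "\<not> concurrent A" "card A = d"
    and A': "finite A'" "A' \<subseteq> proj_lines" "\<not> concurrent A'" "card A' = d"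
    and r: "real r < (real d - 2) / 2" "r < min_deg A'"
    using ce by (auto simp: counterexample_def arrangement_def r_def)
  have "real d > 2 * real r + 2"
    using r(1) by (simp add: field_simps)
  then have d: "d > 2 * r + 2"
    by linarith
  have bij: "bij_betw \<phi> A A'"
    using iso by (simp add: lattice_iso_def)
  have L': "\<phi> L \<in> A'"
    using bij L by (auto simp: bij_betw_def)
  have cards: "card B = d - 1" "card B' = d - 1"
    using A A' L L' by (simp_all add: B_def B'_def)
  have ne: "B \<noteq> {}" "B' \<noteq> {}"
    using cards d by auto
  have B: "finite B" "B \<subseteq> proj_lines" and B': "finite B'" "B' \<subseteq> proj_lines"
    using A A' by (auto simp: B_def B'_def)
  have bijB: "bij_betw \<phi> B B'"
    unfolding B_def B'_def using bij L by (auto simp: bij_betw_def inj_on_def)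
  have isoB: "lattice_iso \<phi> B B'"
    using iso bijB by (auto simp: lattice_iso_def B_def)
  have "has_syzygy r A"
    unfolding r_def using A L by (intro has_syzygy_min_deg) auto
  \<comment> \<open>Positivity makes \<open>r - 1\<close> a true subtraction.\<close>
  then have r1: "r \<ge> 1"
    using concurrent_iff_has_syzygy_0[OF A(1,2)] A(3) by (cases r) auto
  have le: "min_deg B \<le> r" "r \<le> Suc (min_deg B)"
    unfolding B_def r_def using A L ne(1) unfolding B_def
    by (intro min_deg_remove_line_le min_deg_le_Suc_remove_line; blast)+
  then show "min_deg B \<in> {r - 1, r}"
    by auto
  \<comment> \<open>Removal of a line lowers the minimal degree by at most one, and
    \<open>min_deg A'\<close> exceeds \<open>r\<close> strictly.\<close>
  have "min_deg A' \<le> Suc (min_deg B')"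
    unfolding B'_def using A' L' ne(2) unfolding B'_def
    by (intro min_deg_le_Suc_remove_line) auto
  then show r': "min_deg B' \<ge> r"
    using r by simp
  show "num_singular_on A L \<le> r + 1" if "min_deg B = r"
    using num_singular_on_le[OF A(1,2) L] ne A(3) that by (simp add: B_def r_def)
  \<comment> \<open>If \<open>B'\<close> were concurrent, inserting a line would give
    \<open>min_deg A' \<le> 1\<close>, against \<open>min_deg A' > r \<ge> 1\<close>. That
    \<open>B\<close> is not concurrent then follows through the lattice isomorphism.\<close>
  have ncB': "\<not> concurrent B'"
  proof
    assume "concurrent B'"
    then have "has_syzygy 0 B'"
      using concurrent_iff_has_syzygy_0[OF B'] by simp
    then have "min_deg A' \<le> Suc 0"
      using has_syzygy_insert_line[OF A'(1,2) L'] ne(2) unfolding B'_def by (intro min_deg_le)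
    then show False
      using r r1 by simp
  qed
  have "\<phi> ` B = B'"
    using bijB by (simp add: bij_betw_def)
  then have ncB: "\<not> concurrent B"
    using isoB ncB' by (auto simp: lattice_iso_def)
  \<comment> \<open>Passing to \<open>d - 1\<close> lowers the bound by one half while the minimal
    degree drops by one, so the inequality persists; moreover
    \<open>r - 1 < r \<le> min_deg B'\<close>.\<close>
  show "counterexample (d - 1) B B'" if "min_deg B = r - 1"
    unfolding counterexample_def arrangement_def
    using B B' ncB ncB' cards isoB that r(1) r1 r' d by (auto simp: of_nat_diff field_simps)
  show "max_multiplicity B \<le> max_multiplicity A"
    using A B cards d by (intro max_multiplicity_mono) (auto simp: B_def)
qed

theorem lemma3p4:
  fixes A A' B B' :: "(complex ^ 3) set set"
    and \<phi> :: "(complex ^ 3) set \<Rightarrow> (complex ^ 3) set"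
    and L :: "(complex ^ 3) set"
    and d r m :: nat
  assumes "counterexample d A A'"
    and "lattice_iso \<phi> A A'"
    and "r = min_deg A"
    and "m = max_multiplicity A"
    and "L \<in> A"
    and "B = A - {L}"
    and "B' = A' - {\<phi> L}"
  shows "min_deg B \<in> {r - 1, r} \<and> min_deg B' \<ge> r
    \<and> (min_deg B = r \<longrightarrow> num_singular_on A L \<le> r + 1)
    \<and> (min_deg B = r - 1 \<longrightarrow>
         counterexample (d - 1) B B' \<and> min_deg B = r - 1 \<and> max_multiplicity B \<le> m)
    \<and> ((\<nexists>C C'. counterexample (d - 1) C C' \<and> min_deg C = r - 1 \<and> max_multiplicity C \<le> m)
         \<longrightarrow> (\<forall>M\<in>A. num_singular_on A M \<le> r + 1))"
proof -
  note remove = counterexample_remove_line[OF assms(1,2), folded assms(3,4)]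
  \<comment> \<open>Without a smaller pair, removing any line \<open>M\<close> cannot lower the
    minimal degree, so the bound of the first case holds on every line.\<close>
  have "num_singular_on A M \<le> r + 1"
    if "\<nexists>C C'. counterexample (d - 1) C C' \<and> min_deg C = r - 1 \<and> max_multiplicity C \<le> m"
      and "M \<in> A" for M
    using that remove[OF that(2)] by blast
  then show ?thesis
    unfolding assms(6,7) using remove[OF assms(5)] by blast
qed

end
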